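(* Let $a,b\in\mathbb D$, $0\le\gamma<2\pi$, $0<\beta<\pi$, $a'=|1+a|-1$, $b'=|1+b|-1$, $\gamma_a=\arg(1+\overline a)$, $\gamma_b=\arg(1+\overline b)$. Suppose $f_1=h_1+\overline{g_1}\in\mathcal S(H^a_\gamma)$ with $h_1(z)+e^{-2i(\gamma+\gamma_a)}g_1(z)=\frac{(1+a')z}{1-e^{i(\gamma+\gamma_a)}z}$, and $f_2=h_2+\overline{g_2}\in\mathcal S(\Omega^b_\beta)$ with $h_2(z)+e^{-2i\gamma_b}g_2(z)=\frac{(1+b')e^{-i\gamma_b}}{2i\sin\beta}\log\left(\frac{1+ze^{i(\beta+\gamma_b)}}{1+ze^{-i(\beta-\gamma_b)}}\right)$. If $f_1*f_2$ is locally univalent in $\mathbb D$, then $f_1*f_2$ is univalent and convex in the direction $-(\gamma+\gamma_a+\gamma_b)$.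
   Context: $\mathbb D$ is the open unit disk. Harmonic $f=h+\overline g$ on $\mathbb D$ ($h,g$ analytic, $g(0)=0$); $\mathcal H$: those with $h(0)=g(0)=0$, $h'(0)=1$; $\mathcal S_H$: sense-preserving ($|h'|>|g'|$) univalent members of $\mathcal H$. $H^a_\gamma=\{w:\mathrm{Re}(\frac{e^{i\gamma}}{1+a}w)>-\frac12\}$, $\mathcal S(H^a_\gamma)=\{f\in\mathcal S_H:f(\mathbb D)=H^a_\gamma\}$; $\Omega^b_\beta=\{w:\frac{\beta-\pi}{2\sin\beta}<\mathrm{Re}(\frac{w}{1+b})<\frac{\beta}{2\sin\beta}\}$, $\mathcal S(\Omega^b_\beta)=\{f\in\mathcal S_H:f(\mathbb D)=\Omega^b_\beta\}$. Harmonic convolution: for $f=\sum a_nz^n+\sum\overline{b_n}\,\overline z^n$, $F=\sum A_nz^n+\sum\overline{B_n}\,\overline z^n$, $f*F=\sum a_nA_nz^n+\sum\overline{b_nB_n}\,\overline z^n$. A univalent map $f$ on $\mathbb D$ is convex in the direction $\alpha\in\mathbb R$ (taken modulo $\pi$) if the intersection of $f(\mathbb D)$ with every line parallel to the line through $0$ and $e^{i\alpha}$ is an interval or empty. Logarithms are principal branches vanishing at $0$. *)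

theory Defs
  imports "HOL-Complex_Analysis.Complex_Analysis"
begin

abbreviation disk :: "complex set" where "disk \<equiv> ball 0 1"

definition harm :: "(complex \<Rightarrow> complex) \<Rightarrow> (complex \<Rightarrow> complex) \<Rightarrow> complex \<Rightarrow> complex" where
  "harm h g = (\<lambda>z. h z + cnj (g z))"

definition in_SH :: "(complex \<Rightarrow> complex) \<Rightarrow> (complex \<Rightarrow> complex) \<Rightarrow> bool" where
  "in_SH h g \<longleftrightarrow> h holomorphic_on disk \<and> g holomorphic_on disk \<and>
     h 0 = 0 \<and> g 0 = 0 \<and> deriv h 0 = 1 \<and>
     (\<forall>z\<in>disk. norm (deriv g z) < norm (deriv h z)) \<and>
     inj_on (harm h g) disk"

definition H_half :: "complex \<Rightarrow> real \<Rightarrow> complex set" where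
  "H_half a \<gamma> = {w. Re (exp (\<i> * of_real \<gamma>) / (1 + a) * w) > - 1/2}"

definition Omega_strip :: "complex \<Rightarrow> real \<Rightarrow> complex set" where
  "Omega_strip b \<beta> = {w. (\<beta> - pi) / (2 * sin \<beta>) < Re (w / (1 + b)) \<and>
                            Re (w / (1 + b)) < \<beta> / (2 * sin \<beta>)}"

definition in_S_dom :: "complex set \<Rightarrow> (complex \<Rightarrow> complex) \<Rightarrow> (complex \<Rightarrow> complex) \<Rightarrow> bool" where
  "in_S_dom \<Omega> h g \<longleftrightarrow> in_SH h g \<and> harm h g ` disk = \<Omega>"

definition tcoeff :: "(complex \<Rightarrow> complex) \<Rightarrow> nat \<Rightarrow> complex" where
  "tcoeff h n = (deriv ^^ n) h 0 / of_nat (fact n)"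

definition hadamard :: "(complex \<Rightarrow> complex) \<Rightarrow> (complex \<Rightarrow> complex) \<Rightarrow> complex \<Rightarrow> complex" where
  "hadamard h1 h2 = (\<lambda>z. \<Sum>n. tcoeff h1 n * tcoeff h2 n * z ^ n)"

definition harm_conv :: "(complex \<Rightarrow> complex) \<Rightarrow> (complex \<Rightarrow> complex) \<Rightarrow>
     (complex \<Rightarrow> complex) \<Rightarrow> (complex \<Rightarrow> complex) \<Rightarrow> complex \<Rightarrow> complex" where
  "harm_conv h1 g1 h2 g2 = harm (hadamard h1 h2) (hadamard g1 g2)"

definition locally_univalent :: "(complex \<Rightarrow> complex) \<Rightarrow> complex set \<Rightarrow> bool" where
  "locally_univalent F S \<longleftrightarrow> (\<forall>z\<in>S. \<exists>r>0. inj_on F (ball z r))"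

text \<open>Univalent on the disk and convex in direction \<alpha>: every line parallel to the
  line through 0 and exp(i\<alpha>) meets the image in an interval or the empty set
  (for a subset of a line, being an interval is the same as being convex).\<close>
definition convex_in_direction :: "(complex \<Rightarrow> complex) \<Rightarrow> real \<Rightarrow> bool" where
  "convex_in_direction F \<alpha> \<longleftrightarrow> inj_on F disk \<and>
     (\<forall>w. convex (F ` disk \<inter> {w + of_real t * exp (\<i> * of_real \<alpha>) | t. True}))"

end

(* A harmonic map f = H + cnj K shares its imaginary part with the analytic function H - K. On each
   level set of Im (H - K) that is an arc, a locally injective f is therefore strictly monotone along a
   horizontal line, and horizontal convexity and univalence of f follow at once (the shear argument).
   After a rotation the strip map parametrizes the disk by a vertical strip; there the level sets are
   graphs over an interval as soon as G = (H - K) o Z satisfies Re G' > 0: Im G increases along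
   verticals, and a maximum principle on tall rectangles shows that its limits at the two ends of the
   strip are quasi-concave resp. quasi-convex in the abscissa.
   To get Re G' > 0, let k1, k2 be the unimodular multiples of g1, g2 in the hypotheses and write
   2 (h1 * h2 - k1 * k2) = (h1 - k1) * (h2 + k2) + (h1 + k1) * (h2 - k2), a Hadamard product throughout.
   In the derivative, the known sums h + k turn the second term into a value of (h2 - k2)' and the first
   into the difference of h1 - k1 at two points. Both are controlled by the dilatations; for the
   difference one integrates along a segment in the half plane onto which h1 + k1 maps the disk. *)

theory Submission
  imports Defs
begin

section \<open>Shears over a vertical strip\<close>

text \<open>Noshiro-Warschawski argument: by convexity the segment from \<open>v\<close> to
  \<open>u\<close> stays in \<open>S\<close>, and the quotient is the mean of \<open>deriv B\<close>
  over that segment.\<close>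

lemma Re_difference_quotient_pos:
  assumes "convex S" "open S" "B holomorphic_on S" and pos: "\<And>u. u \<in> S \<Longrightarrow> Re (deriv B u) > 0"
    and "u \<in> S" "v \<in> S" "u \<noteq> v"
  shows "Re ((B u - B v) / (u - v)) > 0"
proof -
  define p where "p x = v + x *\<^sub>R (u - v)" for x :: real
  have pS: "p x \<in> S" if "0 \<le> x" "x \<le> 1" for x
    using convexD_alt[OF assms(1,6,5) that] by (simp add: p_def algebra_simps)
  have der: "((\<lambda>x. Re (B (p x) / (u - v))) has_real_derivative Re (deriv B (p x))) (at x)"
    if "0 \<le> x" "x \<le> 1" for x
  proof -
    have "(B has_field_derivative deriv B (p x)) (at (p x))"
      using assms(2,3) pS[OF that] holomorphic_derivI by blast
    moreover have "(p has_vector_derivative (u - v)) (at x)"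
      unfolding p_def has_vector_derivative_def by (auto intro!: derivative_eq_intros)
    ultimately have "((B \<circ> p) has_vector_derivative (u - v) * deriv B (p x)) (at x)"
      by (rule field_vector_diff_chain_at[rotated])
    from has_vector_derivative_divide[OF this, of "u - v"]
    have "((\<lambda>x. B (p x) / (u - v)) has_vector_derivative deriv B (p x)) (at x)"
      using \<open>u \<noteq> v\<close> by (simp add: o_def)
    from bounded_linear.has_vector_derivative[OF bounded_linear_Re this]
    show ?thesis by (simp add: has_real_derivative_iff_has_vector_derivative)
  qed
  have "Re (B (p 0) / (u - v)) < Re (B (p 1) / (u - v))"
  proof (rule DERIV_pos_imp_increasing[of 0 1 "\<lambda>x. Re (B (p x) / (u - v))"])
    show "\<exists>y. ((\<lambda>x. Re (B (p x) / (u - v))) has_real_derivative y) (at x) \<and> 0 < y"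
      if "0 \<le> x" "x \<le> 1" for x
      using der[OF that] pos[OF pS[OF that]] by blast
  qed simp
  thus ?thesis by (simp add: p_def diff_divide_distrib)
qed

text \<open>Were \<open>k a = k b\<close>, some interior point would be an extremum of
  \<open>k\<close> over \<open>{a..b}\<close>. Near that point \<open>k\<close> is continuous and
  injective, hence strictly monotone, which excludes an extremum.\<close>

lemma local_inj_imp_inj_on_interval:
  fixes k :: "real \<Rightarrow> real"
  assumes J: "is_interval J" and cont: "continuous_on J k"
    and loc: "\<And>x. x \<in> J \<Longrightarrow> \<exists>e>0. inj_on k (J \<inter> ball x e)"
  shows "inj_on k J"
proof (rule linorder_inj_onI')
  fix a b assume ab: "a \<in> J" "b \<in> J" "a < b"
  have sub: "{a..b} \<subseteq> J"
    using J ab by (meson atLeastAtMost_iff is_interval_1 subsetI)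
  show "k a \<noteq> k b"
  proof
    assume eq: "k a = k b"
    have cab: "continuous_on {a..b} k" using cont sub continuous_on_subset by blast
    obtain M where M: "M \<in> {a..b}" "\<And>y. y \<in> {a..b} \<Longrightarrow> k y \<le> k M"
      using continuous_attains_sup[OF _ _ cab] ab by force
    obtain m where m: "m \<in> {a..b}" "\<And>y. y \<in> {a..b} \<Longrightarrow> k m \<le> k y"
      using continuous_attains_inf[OF _ _ cab] ab by force
    obtain x where x: "a < x" "x < b"
      and ext: "(\<forall>y\<in>{a..b}. k y \<le> k x) \<or> (\<forall>y\<in>{a..b}. k x \<le> k y)"
    \<comment> \<open>If both extreme values equal the common endpoint value, \<open>k\<close> is
      constant and the midpoint serves; otherwise a maximum or a minimum is attained away from both
      endpoints.\<close>
    proof (cases "k M = k a \<and> k m = k a")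
      case True
      have const: "k y = k a" if "y \<in> {a..b}" for y using M(2)[OF that] m(2)[OF that] True by simp
      have mid: "(a + b) / 2 \<in> {a..b}" "a < (a + b) / 2" "(a + b) / 2 < b" using ab by auto
      have "\<forall>y\<in>{a..b}. k y \<le> k ((a + b) / 2)"
        using const const[OF mid(1)] by (metis order_refl)
      thus ?thesis using mid by (intro that[of "(a + b) / 2"]) auto
    next
      case False
      then consider "M \<noteq> a" "M \<noteq> b" | "m \<noteq> a" "m \<noteq> b" using eq by metis
      thus ?thesis
      proof cases
        case 1
        thus ?thesis using M by (intro that[of M]) (auto simp: less_le)
      next
        case 2
        thus ?thesis using m by (intro that[of m]) (auto simp: less_le)
      qed
    qed
    have "x \<in> J" using x sub by auto
    then obtain e where e: "e > 0" "inj_on k (J \<inter> ball x e)" using loc by blast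
    define d where "d = min (e/2) (min (x - a) (b - x))"
    have d: "d > 0" "d < e" "a \<le> x - d" "x + d \<le> b" using x e unfolding d_def by linarith+
    have s: "{x-d..x+d} \<subseteq> J \<inter> ball x e" using d sub by (auto simp: dist_real_def)
    have "inj_on k {x-d..x+d}" using e(2) s inj_on_subset by blast
    moreover have "continuous_on {x-d..x+d} k" using cont s continuous_on_subset by blast
    ultimately have "(k (x-d) < k x \<and> k x < k (x+d)) \<or> (k (x+d) < k x \<and> k x < k (x-d))"
      using continuous_inj_imp_mono[of "x-d" x "x+d" k] d by auto
    moreover have "x - d \<in> {a..b}" "x + d \<in> {a..b}" using d by auto
    ultimately show False using ext by (meson linorder_not_less)
  qed
qed

text \<open>This is the quasi-concavity in the abscissa of the upper limits of \<open>Im G\<close>.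
  On a tall rectangle the vertical sides carry values at least \<open>e > c\<close>, and the
  uncontrolled horizontal sides are outweighed by a barrier that is small at mid-height.\<close>

lemma vertical_strip_level_lift:
  fixes G :: "complex \<Rightarrow> complex"
  assumes hol: "G holomorphic_on {t. l < Re t \<and> Re t < r}"
    and mono: "\<And>x y y'. \<lbrakk>l < x; x < r; y \<le> y'\<rbrakk> \<Longrightarrow> Im (G (Complex x y)) \<le> Im (G (Complex x y'))"
    and x: "l < x1" "x1 < x" "x < x2" "x2 < r"
    and c: "c < Im (G (Complex x1 y1))" "c < Im (G (Complex x2 y2))"
  shows "\<exists>y. c < Im (G (Complex x y))"
proof -
  define y0 where "y0 = max y1 y2"
  define e where "e = min (Im (G (Complex x1 y0))) (Im (G (Complex x2 y0)))"
  have "Im (G (Complex x1 y1)) \<le> Im (G (Complex x1 y0))" "Im (G (Complex x2 y2)) \<le> Im (G (Complex x2 y0))"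
    using mono x by (auto simp: y0_def)
  hence ec: "c < e" using c by (auto simp: e_def)
  have contG: "continuous_on {t. l < Re t \<and> Re t < r} G"
    using hol holomorphic_on_imp_continuous_on by blast
  have "continuous_on {x1..x2} (\<lambda>s. Im (G (Complex s y0)))"
    unfolding Complex_eq
    by (intro continuous_intros continuous_on_compose2[OF contG]) (use x in auto)
  then obtain s0 where s0: "\<And>s. s \<in> {x1..x2} \<Longrightarrow> Im (G (Complex s0 y0)) \<le> Im (G (Complex s y0))"
    using continuous_attains_inf[of "{x1..x2}" "\<lambda>s. Im (G (Complex s y0))"] x by force
  \<comment> \<open>A bound for how far \<open>Im G\<close> can drop below \<open>e\<close>: since
    it grows upwards, its minimum on the base segment controls it on everything above.\<close>
  define K where "K = max 0 (e - Im (G (Complex s0 y0)))"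
  have K0: "K \<ge> 0" by (simp add: K_def)
  have low: "e - K \<le> Im (G (Complex s y))" if "x1 \<le> s" "s \<le> x2" "y0 \<le> y" for s y
    using s0[of s] mono[of s y0 y] that x by (auto simp: K_def)
  have side: "e \<le> Im (G (Complex s y))" if "s = x1 \<or> s = x2" "y0 \<le> y" for s y
    using mono[of s y0 y] that x by (auto simp: e_def)
  \<comment> \<open>This frequency keeps \<open>\<kappa> * (s - m)\<close> within 1/2 < pi/3 of
    zero, so its cosine is at least 1/2; the factor 2 in \<open>C\<close> compensates for
    that.\<close>
  define \<kappa> where "\<kappa> = 1 / (x2 - x1)"
  have \<kappa>: "\<kappa> > 0" using x by (simp add: \<kappa>_def)
  \<comment> \<open>Any height with \<open>cosh (\<kappa> * h) > 2 * K / (e - c)\<close> would do;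
    for this one the bound follows from \<open>1 + x \<le> exp x \<le> 2 * cosh x\<close>.\<close>
  define h where "h = (2 * (2 * K / (e - c)) + 1) / \<kappa>"
  have ratio0: "2 * K / (e - c) \<ge> 0" using K0 ec by simp
  have h0: "h > 0" unfolding h_def using \<kappa> ratio0 by (intro divide_pos_pos) linarith+
  have kh: "\<kappa> * h = 2 * (2 * K / (e - c)) + 1" using \<kappa> by (simp add: h_def)
  have "2 * K / (e - c) < cosh (\<kappa> * h)"
  proof -
    have "1 + \<kappa> * h \<le> exp (\<kappa> * h)" by (rule exp_ge_add_one_self)
    also have "exp (\<kappa> * h) \<le> 2 * cosh (\<kappa> * h)" by (simp add: cosh_def)
    finally show ?thesis using kh by linarith
  qed
  hence Ch: "2 * K / cosh (\<kappa> * h) < e - c"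
    using ec cosh_real_pos[of "\<kappa> * h"] by (simp add: field_simps)
  \<comment> \<open>The real part of \<open>C cos (\<kappa> (t - centre))\<close> is a harmonic barrier: at least \<open>K\<close> on the horizontal
    sides of the rectangle, nonnegative on the vertical ones, but at most \<open>C < e - c\<close> at the centre line.\<close>
  define C where "C = 2 * K / cosh (\<kappa> * h)"
  have C0: "C \<ge> 0" using K0 cosh_real_pos[of "\<kappa> * h"] by (simp add: C_def)
  define m where "m = (x1 + x2) / 2"
  define f where "f t = \<i> * G t - of_real C * cos (of_real \<kappa> * (t - Complex m (y0 + h)))" for t
  have Ref: "Re (f (Complex s y)) = - Im (G (Complex s y)) - C * (cos (\<kappa> * (s - m)) * cosh (\<kappa> * (y - (y0 + h))))" for s y
    by (simp add: f_def Re_cos cosh_def)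
  have cosl: "1/2 \<le> cos (\<kappa> * (s - m))" if "x1 \<le> s" "s \<le> x2" for s
  proof -
    have "\<bar>s - m\<bar> \<le> (x2 - x1) / 2" using that unfolding m_def by (auto simp: field_simps abs_if)
    hence "\<bar>\<kappa> * (s - m)\<bar> \<le> 1/2" using \<kappa> x by (simp add: \<kappa>_def abs_mult field_simps)
    moreover have "1/2 \<le> pi/3" using pi_gt3 by simp
    ultimately have "cos (pi/3) \<le> cos \<bar>\<kappa> * (s - m)\<bar>" by (intro cos_monotone_0_pi_le) auto
    thus ?thesis by (simp add: cos_60)
  qed
  define S where "S = cbox (Complex x1 y0) (Complex x2 (y0 + 2 * h))"
  have Ss: "S \<subseteq> {t. l < Re t \<and> Re t < r}" using x by (auto simp: S_def in_cbox_complex_iff)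
  have "f holomorphic_on {t. l < Re t \<and> Re t < r}"
    unfolding f_def by (intro holomorphic_intros hol)
  hence fh: "f holomorphic_on S" using Ss holomorphic_on_subset by blast
  have "Re (f (Complex x (y0 + h))) \<le> - e"
  proof (rule maximum_real_frontier[of f S])
    show "f holomorphic_on interior S" using fh interior_subset holomorphic_on_subset by blast
    show "continuous_on (closure S) f"
      using fh by (simp add: S_def holomorphic_on_imp_continuous_on)
    show "bounded S" by (simp add: S_def)
    show "Complex x (y0 + h) \<in> S" using x h0 by (auto simp: S_def in_cbox_complex_iff)
    fix t assume "t \<in> frontier S"
    hence t: "t \<in> cbox (Complex x1 y0) (Complex x2 (y0 + 2*h))" "t \<notin> box (Complex x1 y0) (Complex x2 (y0 + 2*h))"
      by (auto simp: S_def frontier_cbox)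
    obtain s y where ty: "t = Complex s y" by (cases t)
    have sy: "x1 \<le> s" "s \<le> x2" "y0 \<le> y" "s = x1 \<or> s = x2 \<or> y = y0 \<or> y = y0 + 2 * h"
      using t by (auto simp: ty in_cbox_complex_iff in_box_complex_iff)
    have cg: "cosh (\<kappa> * (y - (y0 + h))) \<ge> 1" by (rule cosh_real_ge_1)
    have nn: "C * (cos (\<kappa> * (s - m)) * cosh (\<kappa> * (y - (y0 + h)))) \<ge> 0"
      using C0 cg cosl[OF sy(1,2)] by (intro mult_nonneg_nonneg) auto
    show "Re (f t) \<le> - e"
    proof (cases "s = x1 \<or> s = x2")
      case True
      thus ?thesis using side[OF True sy(3)] nn by (simp add: ty Ref)
    next
      case False
      hence "y - (y0 + h) = - h \<or> y - (y0 + h) = h" using sy(4) by auto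
      hence "cosh (\<kappa> * (y - (y0 + h))) = cosh (\<kappa> * h)"
        by (elim disjE) (simp_all only: mult_minus_right cosh_minus)
      hence *: "C * (cos (\<kappa> * (s - m)) * cosh (\<kappa> * (y - (y0 + h)))) = C * (cos (\<kappa> * (s - m)) * cosh (\<kappa> * h))" by simp
      have "C * (1/2 * cosh (\<kappa> * h)) \<le> C * (cos (\<kappa> * (s - m)) * cosh (\<kappa> * h))"
        using C0 cosl[OF sy(1,2)] cosh_real_pos[of "\<kappa> * h"] by (intro mult_left_mono mult_right_mono) auto
      moreover have "C * (1/2 * cosh (\<kappa> * h)) = K"
        using cosh_real_pos[of "\<kappa> * h"] by (simp add: C_def)
      ultimately show ?thesis using low[OF sy(1-3)] unfolding ty Ref * by linarith
    qed
  qed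
  moreover have "C * cos (\<kappa> * (x - m)) \<le> C" using mult_left_mono[OF cos_le_one C0] by simp
  ultimately have "e - C \<le> Im (G (Complex x (y0 + h)))" by (simp add: Ref)
  thus ?thesis using Ch by (intro exI[of _ "y0 + h"]) (simp add: C_def)
qed

text \<open>Lifting yields a point above \<open>c\<close> on the middle line, lifting after a half
  turn yields one below, and the intermediate value theorem joins them.\<close>

lemma strip_level_between:
  assumes hol: "G holomorphic_on {t. l < Re t \<and> Re t < r}"
    and mono: "\<And>x y y'. \<lbrakk>l < x; x < r; y < y'\<rbrakk> \<Longrightarrow> Im (G (Complex x y)) < Im (G (Complex x y'))"
    and x: "l < x1" "x1 < x" "x < x2" "x2 < r"
    and c: "Im (G (Complex x1 y1)) = c" "Im (G (Complex x2 y2)) = c"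
  shows "\<exists>y. Im (G (Complex x y)) = c"
proof -
  have mono': "Im (G (Complex s y)) \<le> Im (G (Complex s y'))" if "l < s" "s < r" "y \<le> y'" for s y y'
    using mono[of s y y'] that by (cases "y = y'") auto
  \<comment> \<open>One unit above the two given points strict monotonicity makes the values exceed
    \<open>c\<close>.\<close>
  obtain u where u: "c < Im (G (Complex x u))"
    using vertical_strip_level_lift[OF hol mono' x, of c "y1 + 1" "y2 + 1"]
      mono[of x1 y1 "y1 + 1"] mono[of x2 y2 "y2 + 1"] c x by auto
  have neg: "- Complex a b = Complex (- a) (- b)" for a b by (simp add: complex_eq_iff)
  \<comment> \<open>Replacing \<open>G t\<close> by \<open>- G (- t)\<close> exchanges the two ends
    of the strip and keeps the imaginary part increasing along verticals.\<close>
  have "(\<lambda>t. - G (- t)) holomorphic_on {t. - r < Re t \<and> Re t < - l}"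
    by (intro holomorphic_intros holomorphic_on_compose_gen[OF _ hol, of uminus, unfolded o_def]) auto
  moreover have "Im (- G (- Complex s y)) \<le> Im (- G (- Complex s y'))"
    if "- r < s" "s < - l" "y \<le> y'" for s y y'
    using mono'[of "- s" "- y'" "- y"] that by (simp add: neg)
  ultimately obtain v where "- c < Im (- G (- Complex (- x) v))"
    using vertical_strip_level_lift[of "\<lambda>t. - G (- t)" "- r" "- l" "- x2" "- x" "- x1" "- c" "1 - y2" "1 - y1"]
      mono[of x1 "y1 - 1" y1] mono[of x2 "y2 - 1" y2] c x by (auto simp: neg)
  hence v: "Im (G (Complex x (- v))) < c" by (simp add: neg)
  have "- v < u" using mono'[of x u "- v"] u v x by force
  have "continuous_on {- v..u} (\<lambda>y. Im (G (Complex x y)))"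
    unfolding Complex_eq
    by (intro continuous_intros continuous_on_compose2[OF holomorphic_on_imp_continuous_on[OF hol]]) (use x in auto)
  thus ?thesis using IVT'[of "\<lambda>y. Im (G (Complex x y))" "- v" c u] u v \<open>- v < u\<close> by force
qed

lemma strip_shear_level:
  fixes G q :: "complex \<Rightarrow> complex" and l r c :: real
  defines "S \<equiv> {t. l < Re t \<and> Re t < r}"
  assumes hol: "G holomorphic_on S" and pos: "\<And>t. t \<in> S \<Longrightarrow> Re (deriv G t) > 0"
    and contq: "continuous_on S q" and Imq: "\<And>t. t \<in> S \<Longrightarrow> Im (q t) = Im (G t)"
    and loc: "\<And>t. t \<in> S \<Longrightarrow> \<exists>e>0. inj_on q (S \<inter> ball t e)"
  shows "inj_on q {t \<in> S. Im (G t) = c}" "is_interval {x. Complex x c \<in> q ` S}"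
proof -
  have convS: "convex S"
    unfolding S_def Collect_conj_eq by (intro convex_Int convex_halfspace_Re_lt convex_halfspace_Re_gt)
  have openS: "open S"
    unfolding S_def Collect_conj_eq by (intro open_Int open_halfspace_Re_lt open_halfspace_Re_gt)
  have contG: "continuous_on S G" using hol holomorphic_on_imp_continuous_on by blast
  have mono: "Im (G (Complex x y)) < Im (G (Complex x y'))" if "l < x" "x < r" "y < y'" for x y y'
  proof -
    \<comment> \<open>On a vertical segment the denominator is \<open>\<i>\<close> times a positive
      real, so the real part of the difference quotient is the growth rate of
      \<open>Im G\<close>.\<close>
    have d: "Complex x y' - Complex x y = \<i> * of_real (y' - y)" by (simp add: complex_eq_iff)
    have "0 < Re ((G (Complex x y') - G (Complex x y)) / (Complex x y' - Complex x y))"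
      using that by (intro Re_difference_quotient_pos[OF convS openS hol pos]) (auto simp: S_def)
    also have "\<dots> = (Im (G (Complex x y')) - Im (G (Complex x y))) / (y' - y)"
      unfolding d using that(3) by (simp add: Re_divide power2_eq_square)
    finally show ?thesis using that(3) by (simp add: zero_less_divide_iff)
  qed
  have mono_le: "y \<le> y'" if "l < x" "x < r" "Im (G (Complex x y)) \<le> Im (G (Complex x y'))" for x y y'
    using mono[of x y' y] that by force
  have mono_less: "y < y'" if "l < x" "x < r" "Im (G (Complex x y)) < Im (G (Complex x y'))" for x y y'
    using mono[of x y' y] that by (cases "y = y'") force+
  define J where "J = {x. l < x \<and> x < r \<and> (\<exists>y. Im (G (Complex x y)) = c)}"
  define Y where "Y x = (SOME y. Im (G (Complex x y)) = c)" for x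
  have Y: "Im (G (Complex x (Y x))) = c" if "x \<in> J" for x
    using that unfolding J_def Y_def by (auto intro: someI_ex)
  have Y_unique: "Y (Re t) = Im t" "Re t \<in> J" if "t \<in> S" "Im (G t) = c" for t
  proof -
    have t: "t = Complex (Re t) (Im t)" "l < Re t" "Re t < r" using that by (auto simp: S_def)
    show "Re t \<in> J" unfolding J_def using t(2,3) that(2) by (auto intro!: exI[of _ "Im t"])
    from Y[OF this] show "Y (Re t) = Im t"
      using mono_le[OF t(2,3), of "Y (Re t)" "Im t"] mono_le[OF t(2,3), of "Im t" "Y (Re t)"] that(2)
      by (metis t(1) order_antisym order_refl)
  qed
  have J: "is_interval J"
    unfolding is_interval_1
  proof (intro ballI allI impI)
    fix x1 x2 x assume x: "x1 \<in> J" "x2 \<in> J" "x1 \<le> x \<and> x \<le> x2"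
    have "\<exists>y. Im (G (Complex x y)) = c" if "x1 < x" "x < x2"
      using strip_level_between[OF hol[unfolded S_def] mono _ that _ Y[OF x(1)] Y[OF x(2)]] x
      by (auto simp: J_def)
    thus "x \<in> J" using x by (cases "x = x1"; cases "x = x2") (auto simp: J_def)
  qed
  have slice: "((\<lambda>s. Im (G (Complex s y))) \<longlongrightarrow> Im (G (Complex x y))) (at x within J)" if "x \<in> J" for x y
  proof -
    have "continuous_on {l<..<r} (\<lambda>s. Im (G (Complex s y)))"
      unfolding Complex_eq
      by (intro continuous_intros continuous_on_compose2[OF contG]) (auto simp: S_def)
    moreover have "J \<subseteq> {l<..<r}" by (auto simp: J_def)
    ultimately have "continuous_on J (\<lambda>s. Im (G (Complex s y)))" by (rule continuous_on_subset)
    thus ?thesis using that by (simp add: continuous_on_def)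
  qed
  have contY: "continuous_on J Y"
    unfolding continuous_on_def
  proof (intro ballI tendstoI)
    fix x and e :: real assume x: "x \<in> J" and e: "e > 0"
    have lr: "l < x" "x < r" using x by (auto simp: J_def)
    \<comment> \<open>The strict inequalities at heights \<open>Y x - e\<close> and
      \<open>Y x + e\<close> persist for nearby abscissae, and monotonicity along verticals traps
      \<open>Y s\<close> between these heights.\<close>
    have "Im (G (Complex x (Y x - e))) < c" "c < Im (G (Complex x (Y x + e)))"
      using mono[OF lr, of "Y x - e" "Y x"] mono[OF lr, of "Y x" "Y x + e"] Y[OF x] e by auto
    hence "\<forall>\<^sub>F s in at x within J. Im (G (Complex s (Y x - e))) < c"
      "\<forall>\<^sub>F s in at x within J. c < Im (G (Complex s (Y x + e)))"
      using order_tendstoD[OF slice[OF x]] by blast+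
    moreover have "\<forall>\<^sub>F s in at x within J. s \<in> J" by (simp add: eventually_at_filter)
    ultimately show "\<forall>\<^sub>F s in at x within J. dist (Y s) (Y x) < e"
    proof eventually_elim
      case (elim s)
      have s: "l < s" "s < r" using elim(3) by (auto simp: J_def)
      have "Y x - e < Y s" using mono_less[OF s] elim(1) Y[OF elim(3)] by simp
      moreover have "Y s < Y x + e" using mono_less[OF s] elim(2) Y[OF elim(3)] by simp
      ultimately show ?case by (simp add: dist_real_def abs_less_iff)
    qed
  qed
  define \<sigma> where "\<sigma> x = Complex x (Y x)" for x
  have cont\<sigma>: "continuous_on J \<sigma>"
    unfolding \<sigma>_def Complex_eq by (intro continuous_intros contY)
  have \<sigma>S: "\<sigma> x \<in> S" if "x \<in> J" for x using that by (auto simp: \<sigma>_def J_def S_def)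
  have q\<sigma>: "q (\<sigma> x) = Complex (Re (q (\<sigma> x))) c" if "x \<in> J" for x
    using Imq[OF \<sigma>S[OF that]] Y[OF that] by (simp add: complex_eq_iff \<sigma>_def)
  define k where "k x = Re (q (\<sigma> x))" for x
  have contk: "continuous_on J k"
    unfolding k_def using \<sigma>S by (intro continuous_intros continuous_on_compose2[OF contq cont\<sigma>]) auto
  have injk: "inj_on k J"
  proof (rule local_inj_imp_inj_on_interval[OF J contk])
    fix x assume x: "x \<in> J"
    obtain e where e: "e > 0" "inj_on q (S \<inter> ball (\<sigma> x) e)" using loc[OF \<sigma>S[OF x]] by blast
    obtain d where d: "d > 0" "\<And>s. s \<in> J \<Longrightarrow> dist s x < d \<Longrightarrow> dist (\<sigma> s) (\<sigma> x) < e"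
      using cont\<sigma> x e(1) unfolding continuous_on_iff by metis
    have "inj_on k (J \<inter> ball x d)"
    proof (rule inj_onI)
      fix s s' assume s: "s \<in> J \<inter> ball x d" "s' \<in> J \<inter> ball x d" "k s = k s'"
      have "q (\<sigma> s) = q (\<sigma> s')" using q\<sigma>[of s] q\<sigma>[of s'] s by (simp add: k_def)
      moreover have "\<sigma> s \<in> S \<inter> ball (\<sigma> x) e" "\<sigma> s' \<in> S \<inter> ball (\<sigma> x) e"
        using s d(2)[of s] d(2)[of s'] \<sigma>S by (auto simp: dist_commute)
      ultimately have "\<sigma> s = \<sigma> s'" using e(2) by (meson inj_onD)
      thus "s = s'" by (simp add: \<sigma>_def)
    qed
    thus "\<exists>e>0. inj_on k (J \<inter> ball x e)" using d(1) by blast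
  qed
  have \<sigma>_Re: "\<sigma> (Re t) = t" if "t \<in> S" "Im (G t) = c" for t
    using Y_unique[OF that] by (simp add: \<sigma>_def complex_eq_iff)
  show "inj_on q {t \<in> S. Im (G t) = c}"
  proof (rule inj_onI)
    fix t t' assume t: "t \<in> {t \<in> S. Im (G t) = c}" "t' \<in> {t \<in> S. Im (G t) = c}" "q t = q t'"
    have "k (Re t) = k (Re t')" using t \<sigma>_Re by (simp add: k_def)
    hence "Re t = Re t'" using injk Y_unique(2) t by (auto dest: inj_onD)
    thus "t = t'" using \<sigma>_Re t by (metis (mono_tags, lifting) mem_Collect_eq)
  qed
  have "{x. Complex x c \<in> q ` S} = k ` J"
  proof (intro equalityI subsetI)
    fix x assume "x \<in> {x. Complex x c \<in> q ` S}"
    then obtain t where t: "t \<in> S" "q t = Complex x c" by auto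
    hence c: "Im (G t) = c" using Imq by force
    show "x \<in> k ` J"
      using Y_unique(2)[OF t(1) c] \<sigma>_Re[OF t(1) c] t(2) by (intro image_eqI[of _ _ "Re t"]) (auto simp: k_def)
  next
    fix x assume "x \<in> k ` J"
    then obtain s where "s \<in> J" "x = k s" by auto
    thus "x \<in> {x. Complex x c \<in> q ` S}" using q\<sigma>[of s] \<sigma>S[of s] unfolding k_def by (metis image_eqI mem_Collect_eq)
  qed
  moreover have "connected (k ` J)"
    using connected_continuous_image[OF contk] J by (simp add: is_interval_connected_1)
  ultimately show "is_interval {x. Complex x c \<in> q ` S}" by (simp add: is_interval_connected_1)
qed

text \<open>Points with equal \<open>q\<close> lie on a common level set of \<open>Im G\<close>,
  where injectivity is already known.\<close>

lemma strip_shear_inj: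
  fixes G q :: "complex \<Rightarrow> complex" and l r :: real
  defines "S \<equiv> {t. l < Re t \<and> Re t < r}"
  assumes "G holomorphic_on S" "\<And>t. t \<in> S \<Longrightarrow> Re (deriv G t) > 0"
    "continuous_on S q" and Imq: "\<And>t. t \<in> S \<Longrightarrow> Im (q t) = Im (G t)"
    and "\<And>t. t \<in> S \<Longrightarrow> \<exists>e>0. inj_on q (S \<inter> ball t e)"
  shows "inj_on q S"
proof (rule inj_onI)
  fix t t' assume t: "t \<in> S" "t' \<in> S" "q t = q t'"
  have "Im (G t) = Im (G t')" using Imq t by metis
  thus "t = t'"
    using strip_shear_level(1)[OF assms(2-6)[unfolded S_def], of "Im (G t)"] t
    by (auto simp: S_def dest!: inj_onD)
qed

section \<open>The disk as image of a vertical strip\<close>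

text \<open>Solving \<open>2 \<i> s = log ((1 + z cis \<beta>) / (1 + z cis (- \<beta>)))\<close> for \<open>z\<close> gives \<open>z = sin s / sin (\<beta> - s)\<close>.\<close>

lemma norm_sin_diff_identity:
  "(norm (sin (of_real \<beta> - s)))\<^sup>2 - (norm (sin s))\<^sup>2 = sin \<beta> * sin (\<beta> - 2 * Re s)"
proof -
  \<comment> \<open>The exponential terms of the two squared norms cancel, because
    \<open>\<beta> - s\<close> and \<open>s\<close> have opposite imaginary parts.\<close>
  have "(norm (sin (of_real \<beta> - s)))\<^sup>2 - (norm (sin s))\<^sup>2 = (cos (2 * Re s) - cos (2 * (\<beta> - Re s))) / 2"
    unfolding norm_sin_squared by (simp add: exp_minus add.commute right_diff_distrib flip: diff_divide_distrib)
  also have "\<dots> = sin \<beta> * sin (\<beta> - 2 * Re s)"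
  proof -
    have "(2 * Re s + 2 * (\<beta> - Re s)) / 2 = \<beta>" "(2 * (\<beta> - Re s) - 2 * Re s) / 2 = \<beta> - 2 * Re s"
      by (simp_all add: field_simps)
    thus ?thesis
      using cos_diff_cos[of "2 * Re s" "2 * (\<beta> - Re s)"] by (simp only:)
  qed
  finally show ?thesis .
qed

context
  fixes \<beta> :: real
  assumes \<beta>: "0 < \<beta>" "\<beta> < pi"
begin

lemma sin_\<beta>: "sin \<beta> > 0" using \<beta> by (rule sin_gt_zero)

lemma strip_norm_sin_less:
  assumes "(\<beta> - pi) / 2 < Re s" "Re s < \<beta> / 2"
  shows "norm (sin s) < norm (sin (of_real \<beta> - s))"
proof -
  have "0 < sin \<beta> * sin (\<beta> - 2 * Re s)"
    using assms \<beta> by (intro mult_pos_pos sin_gt_zero) auto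
  hence "(norm (sin s))\<^sup>2 < (norm (sin (of_real \<beta> - s)))\<^sup>2"
    using norm_sin_diff_identity[of \<beta> s] by linarith
  thus ?thesis by (rule power2_less_imp_less) (rule norm_ge_zero)
qed

lemma strip_sin_nonzero:
  assumes "(\<beta> - pi) / 2 < Re s" "Re s < \<beta> / 2"
  shows "sin (of_real \<beta> - s) \<noteq> 0"
  using strip_norm_sin_less[OF assms] by (metis norm_not_less_zero norm_zero)

lemma strip_ratio_in_disk:
  assumes "(\<beta> - pi) / 2 < Re s" "Re s < \<beta> / 2"
  shows "norm (sin s / sin (of_real \<beta> - s)) < 1"
  using strip_norm_sin_less[OF assms] le_less_trans[OF norm_ge_zero strip_norm_sin_less[OF assms]]
  by (simp add: norm_divide)

text \<open>The left side is \<open>1 + 2 * z * cos \<beta> + z\<^sup>2\<close>; clearing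
  denominators turns the claim into a law of cosines. It serves to write the derivative of the strip
  parametrization as a polynomial in \<open>z\<close>, namely the quadratic that occurs in the
  derivative of the strip map.\<close>

lemma strip_ratio_quadratic:
  assumes "sin (of_real \<beta> - s) \<noteq> 0"
  defines "z \<equiv> sin s / sin (of_real \<beta> - s)"
  shows "(1 + z * cis \<beta>) * (1 + z * cis (- \<beta>)) = of_real (sin \<beta>) ^ 2 / sin (of_real \<beta> - s) ^ 2"
proof -
  define T where "T = sin (of_real \<beta> - s)"
  have cc: "cis \<beta> + cis (- \<beta>) = 2 * cos (of_real \<beta>)" "cis \<beta> * cis (- \<beta>) = 1"
    by (simp_all add: complex_eq_iff cos_of_real cis_mult)
  \<comment> \<open>Law of cosines for the triangle with angles \<open>s\<close>, \<open>\<beta> - s\<close>, \<open>\<pi> - \<beta>\<close> and circumdiameter 1.\<close>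
  have law: "T\<^sup>2 + 2 * sin s * T * cos (of_real \<beta>) + (sin s)\<^sup>2 = (of_real (sin \<beta>))\<^sup>2"
  proof -
    define sb cb :: complex where "sb = sin (of_real \<beta>)" and "cb = cos (of_real \<beta>)"
    have T: "T = sb * cos s - cb * sin s" by (simp add: T_def sin_diff sb_def cb_def)
    have e: "sb\<^sup>2 + cb\<^sup>2 = 1" "(sin s)\<^sup>2 + (cos s)\<^sup>2 = 1" unfolding sb_def cb_def by (rule sin_cos_squared_add)+
    have "T\<^sup>2 + 2 * sin s * T * cb + (sin s)\<^sup>2 = sb\<^sup>2 * (cos s)\<^sup>2 + (1 - cb\<^sup>2) * (sin s)\<^sup>2"
      unfolding T by (simp add: power2_eq_square algebra_simps)
    also have "1 - cb\<^sup>2 = sb\<^sup>2" using e(1) by (metis add_diff_cancel_right')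
    also have "sb\<^sup>2 * (cos s)\<^sup>2 + sb\<^sup>2 * (sin s)\<^sup>2 = sb\<^sup>2"
      using e(2) by (simp add: add.commute flip: distrib_left)
    finally show ?thesis by (simp add: sb_def cb_def sin_of_real)
  qed
  have z: "T\<^sup>2 * z = sin s * T" "T\<^sup>2 * z\<^sup>2 = (sin s)\<^sup>2"
    using assms(1) by (simp_all add: z_def T_def power2_eq_square)
  have "T\<^sup>2 * ((1 + z * cis \<beta>) * (1 + z * cis (- \<beta>)))
      = T\<^sup>2 + T\<^sup>2 * z * (cis \<beta> + cis (- \<beta>)) + T\<^sup>2 * z\<^sup>2 * (cis \<beta> * cis (- \<beta>))"
    by (simp add: power2_eq_square algebra_simps)
  also have "\<dots> = (of_real (sin \<beta>))\<^sup>2"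
    unfolding cc z using law by (simp add: mult_ac)
  finally have "T\<^sup>2 * ((1 + z * cis \<beta>) * (1 + z * cis (- \<beta>))) = (of_real (sin \<beta>))\<^sup>2" .
  thus ?thesis using assms(1) by (simp add: T_def eq_divide_eq mult.commute)
qed

lemma strip_ratio_deriv:
  assumes "sin (of_real \<beta> - s) \<noteq> 0"
  defines "z \<equiv> sin s / sin (of_real \<beta> - s)"
  shows "((\<lambda>s. sin s / sin (of_real \<beta> - s)) has_field_derivative
     (1 + z * cis \<beta>) * (1 + z * cis (- \<beta>)) / of_real (sin \<beta>)) (at s)"
proof -
  have "((\<lambda>s. sin s / sin (of_real \<beta> - s)) has_field_derivative
     (cos s * sin (of_real \<beta> - s) - sin s * (cos (of_real \<beta> - s) * (-1))) / (sin (of_real \<beta> - s) * sin (of_real \<beta> - s))) (at s)"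
    using assms(1) by (auto intro!: derivative_eq_intros)
  \<comment> \<open>The numerator of the quotient rule is the addition formula for the sine of
    \<open>s + (\<beta> - s)\<close>.\<close>
  moreover have "cos s * sin (of_real \<beta> - s) - sin s * (cos (of_real \<beta> - s) * (-1)) = of_real (sin \<beta>)"
    using sin_add[of s "of_real \<beta> - s"] by (simp add: sin_of_real mult.commute add.commute)
  ultimately show ?thesis
    unfolding z_def strip_ratio_quadratic[OF assms(1)] using sin_\<beta>
    by (simp add: power2_eq_square)
qed

text \<open>Cross-multiplying leaves \<open>sin \<beta> * sin (s - t) = 0\<close>, and the strip is
  too narrow to contain two points that differ by a nonzero multiple of pi.\<close>

lemma strip_ratio_inj:
  "inj_on (\<lambda>s. sin s / sin (of_real \<beta> - s)) {s. (\<beta> - pi) / 2 < Re s \<and> Re s < \<beta> / 2}"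
proof (rule inj_onI)
  fix s t assume s: "s \<in> {s. (\<beta> - pi) / 2 < Re s \<and> Re s < \<beta> / 2}"
    and t: "t \<in> {s. (\<beta> - pi) / 2 < Re s \<and> Re s < \<beta> / 2}"
    and eq: "sin s / sin (of_real \<beta> - s) = sin t / sin (of_real \<beta> - t)"
  have "sin s * sin (of_real \<beta> - t) = sin t * sin (of_real \<beta> - s)"
    using eq strip_sin_nonzero s t by (simp add: field_simps)
  hence "sin (of_real \<beta>) * (sin s * cos t - cos s * sin t) = 0"
    by (simp add: sin_diff algebra_simps)
  moreover have "sin (of_real \<beta> :: complex) \<noteq> 0" using sin_\<beta> by (simp add: sin_of_real)
  ultimately have "sin (s - t) = 0" by (simp add: sin_diff)
  then obtain n :: int where n: "s - t = of_real (of_int n * pi)" by (auto simp: sin_eq_0)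
  hence "Re s - Re t = of_int n * pi" by (metis Re_complex_of_real minus_complex.simps(1))
  moreover have "\<bar>Re s - Re t\<bar> < pi" using s t \<beta> by auto
  ultimately have "\<bar>real_of_int n\<bar> * pi < 1 * pi" by (simp add: abs_mult)
  hence "\<bar>real_of_int n\<bar> < 1" by (simp only: mult_less_cancel_right_pos[OF pi_gt_zero])
  hence "n = 0" by linarith
  thus "s = t" using n by simp
qed

lemma strip_ratio_surj:
  assumes z: "norm z < 1"
  obtains s where "(\<beta> - pi) / 2 < Re s" "Re s < \<beta> / 2" "z = sin s / sin (of_real \<beta> - s)"
proof -
  have nz: "1 + z * cis \<theta> \<noteq> 0" for \<theta>
  proof
    assume "1 + z * cis \<theta> = 0"
    hence "z * cis \<theta> = - 1" by (simp add: add_eq_0_iff)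
    hence "norm (z * cis \<theta>) = 1" by simp
    thus False using z by (simp add: norm_mult)
  qed
  define w where "w = (1 + z * cis \<beta>) / (1 + z * cis (- \<beta>))"
  have w0: "w \<noteq> 0" using nz by (simp add: w_def)
  define s where "s = - \<i> * Ln w / 2"
  have "exp (2 * (\<i> * s)) = w" using w0 by (simp add: s_def)
  hence "exp (\<i> * s) ^ 2 = w" by (simp add: exp_double)
  hence "exp (\<i> * s) ^ 2 * (1 + z * cis (- \<beta>)) = 1 + z * cis \<beta>" using nz by (simp add: w_def)
  moreover have "exp (\<i> * s) * exp (- (\<i> * s)) = 1" by (simp add: exp_minus)
  ultimately have "exp (\<i> * s) - exp (- (\<i> * s)) = z * (cis \<beta> * exp (- (\<i> * s)) - cis (- \<beta>) * exp (\<i> * s))"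
    by algebra
  also have "\<dots> = z * (exp (\<i> * (of_real \<beta> - s)) - exp (- (\<i> * (of_real \<beta> - s))))"
    unfolding cis_conv_exp exp_add[symmetric] by (simp add: right_diff_distrib)
  finally have main: "sin s = z * sin (of_real \<beta> - s)"
    by (simp add: sin_exp_eq)
  have T0: "sin (of_real \<beta> - s) \<noteq> 0"
  proof
    assume "sin (of_real \<beta> - s) = 0"
    hence "sin (of_real \<beta> :: complex) = 0"
      using main sin_add[of s "of_real \<beta> - s"] by simp
    thus False using sin_\<beta> by (simp add: sin_of_real)
  qed
  have "norm (sin s) < norm (sin (of_real \<beta> - s))"
    using T0 z by (simp add: main norm_mult)
  hence "(norm (sin s))\<^sup>2 < (norm (sin (of_real \<beta> - s)))\<^sup>2" by (simp add: power_strict_mono)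
  hence "sin \<beta> * sin (\<beta> - 2 * Re s) > 0" using norm_sin_diff_identity[of \<beta> s] by simp
  hence pos: "sin (\<beta> - 2 * Re s) > 0" using sin_\<beta> by (simp add: zero_less_mult_iff)
  have "2 * Re s = Im (Ln w)" by (simp add: s_def)
  \<comment> \<open>The principal branch puts \<open>\<beta> - 2 * Re s\<close> into the range from
    \<open>\<beta> - pi\<close> to \<open>\<beta> + pi\<close>, where the sine is positive only
    strictly between 0 and pi; this is exactly the strip.\<close>
  hence rng: "- pi < 2 * Re s" "2 * Re s \<le> pi" using w0 mpi_less_Im_Ln Im_Ln_le_pi by simp_all
  have "0 < \<beta> - 2 * Re s"
  proof (rule ccontr)
    assume "\<not> 0 < \<beta> - 2 * Re s"
    hence "0 \<le> sin (- (\<beta> - 2 * Re s))" using rng \<beta> by (intro sin_ge_zero) auto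
    thus False using pos unfolding sin_minus by linarith
  qed
  moreover have "\<beta> - 2 * Re s < pi"
  proof (rule ccontr)
    assume "\<not> \<beta> - 2 * Re s < pi"
    hence "0 \<le> sin ((\<beta> - 2 * Re s) - pi)" using rng \<beta> by (intro sin_ge_zero) auto
    thus False using pos by simp
  qed
  ultimately show ?thesis using that[of s] main T0 by simp
qed

end

section \<open>Hadamard products\<close>

lemma tcoeff_sums:
  assumes "f holomorphic_on disk" "z \<in> disk"
  shows "(\<lambda>n. tcoeff f n * z ^ n) sums f z"
  using holomorphic_power_series[OF assms] by (simp add: tcoeff_def)

text \<open>The extra factor \<open>z\<close> keeps each coefficient at its own exponent, so that
  later coefficientwise products need no index shift.\<close>

lemma power_series_deriv_sums:
  fixes c :: "nat \<Rightarrow> complex"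
  assumes f: "\<And>z. z \<in> disk \<Longrightarrow> (\<lambda>n. c n * z ^ n) sums f z" and z: "z \<in> disk"
  shows "(\<lambda>n. of_nat n * c n * z ^ n) sums (z * deriv f z)"
    and "(f has_field_derivative deriv f z) (at z)"
proof -
  have sm: "summable (\<lambda>n. c n * w ^ n)" if "norm w < 1" for w
    using f[of w] that by (auto simp: sums_iff)
  have "((\<lambda>z. \<Sum>n. c n * z ^ n) has_field_derivative (\<Sum>n. diffs c n * z ^ n)) (at z)"
    using z by (intro termdiffs_strong'[of 1]) (auto intro: sm)
  hence der: "(f has_field_derivative (\<Sum>n. diffs c n * z ^ n)) (at z)"
    by (rule has_field_derivative_transform_within_open[of _ _ _ disk])
       (use z f in \<open>auto simp: sums_iff\<close>)
  hence d: "deriv f z = (\<Sum>n. diffs c n * z ^ n)" by (rule DERIV_imp_deriv)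
  show "(f has_field_derivative deriv f z) (at z)" using der d by simp
  have "summable (\<lambda>n. diffs c n * z ^ n)"
    using z by (intro termdiff_converges[of z 1]) (auto intro: sm)
  hence "(\<lambda>n. z * (diffs c n * z ^ n)) sums (z * deriv f z)"
    unfolding d by (intro sums_mult summable_sums)
  hence "(\<lambda>n. of_nat (Suc n) * c (Suc n) * z ^ Suc n) sums (z * deriv f z)"
    by (simp add: diffs_def mult_ac)
  thus "(\<lambda>n. of_nat n * c n * z ^ n) sums (z * deriv f z)"
    by (subst (asm) sums_Suc_iff) simp
qed

lemma power_series_unique:
  fixes c d :: "nat \<Rightarrow> complex"
  assumes c: "\<And>z. z \<in> disk \<Longrightarrow> (\<lambda>n. c n * z ^ n) sums f z"
    and d: "\<And>z. z \<in> disk \<Longrightarrow> (\<lambda>n. d n * z ^ n) sums f z"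
  shows "c = d"
proof -
  have "(\<lambda>n. (c n - d n) * z ^ n) sums 0" if "z \<in> disk" for z
    using sums_diff[OF c[OF that] d[OF that]] by (simp add: algebra_simps)
  hence z: "(\<lambda>n. (c n - d n) * (z - 0) ^ n) sums (\<lambda>_. 0) z" if "norm (z - 0) < 1" for z :: complex
    using that by simp
  \<comment> \<open>A nonzero difference at a positive index would make 0 an isolated zero of the
    zero function; index 0 is settled by evaluating at 0.\<close>
  have pos: "c m = d m" if "m > 0" for m
  proof (rule ccontr)
    assume "c m \<noteq> d m"
    show False
    proof (rule powser_0_nonzero[of 1 0 "\<lambda>n. c n - d n" "\<lambda>_. 0" m])
      fix s :: real assume "0 < s" "\<And>z. z \<in> cball 0 s - {0::complex} \<Longrightarrow> (0::complex) \<noteq> 0"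
      from this(2)[of "of_real s"] this(1) show False by simp
    qed (use z that \<open>c m \<noteq> d m\<close> in auto)
  qed
  have "(\<lambda>n. c n * 0 ^ n) sums f 0" "(\<lambda>n. d n * 0 ^ n) sums f 0" using c[of 0] d[of 0] by auto
  hence "c 0 = d 0" by (metis powser_sums_zero sums_unique2)
  thus ?thesis using pos by (metis ext gr0I)
qed

text \<open>With \<open>s\<close> the square root of \<open>norm z\<close>, one factor
  \<open>s ^ n\<close> goes to each coefficient: both series converge absolutely at radius
  \<open>s < 1\<close>, and the terms of one are eventually bounded by 1.\<close>

lemma hadamard_sums:
  assumes f: "f holomorphic_on disk" and g: "g holomorphic_on disk" and z: "z \<in> disk"
  shows "(\<lambda>n. tcoeff f n * tcoeff g n * z ^ n) sums hadamard f g z"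
proof -
  define s where "s = sqrt (norm z)"
  have s: "0 \<le> s" "s < 1" "s * s = norm z" using z by (auto simp: s_def)
  obtain t where t: "s < t" "t < 1" using dense s by blast
  have *: "summable (\<lambda>n. norm (tcoeff k n * of_real s ^ n))" if "k holomorphic_on disk" for k
    using powser_insidea[of "tcoeff k" "of_real t" "of_real s"] tcoeff_sums[OF that, of "of_real t"] s t
    by (auto simp: sums_iff)
  have "(\<lambda>n. norm (tcoeff g n * of_real s ^ n)) \<longlonglongrightarrow> 0"
    using *[OF g] by (rule summable_LIMSEQ_zero)
  hence "eventually (\<lambda>n. norm (tcoeff g n * of_real s ^ n) < 1) sequentially"
    by (rule order_tendstoD) simp
  hence "eventually (\<lambda>n. norm (tcoeff f n * tcoeff g n * z ^ n) \<le> norm (tcoeff f n * of_real s ^ n)) sequentially"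
  proof eventually_elim
    case (elim n)
    have "norm (tcoeff f n * tcoeff g n * z ^ n) = norm (tcoeff f n * of_real s ^ n) * norm (tcoeff g n * of_real s ^ n)"
      using s(1) by (simp add: norm_mult norm_power power_mult_distrib flip: s(3))
    also have "\<dots> \<le> norm (tcoeff f n * of_real s ^ n) * 1"
      using elim by (intro mult_left_mono) auto
    finally show ?case by simp
  qed
  hence "summable (\<lambda>n. tcoeff f n * tcoeff g n * z ^ n)"
    by (rule summable_comparison_test_ev[OF _ *[OF f]])
  thus ?thesis by (simp add: hadamard_def summable_sums)
qed

lemma hadamard_holomorphic:
  assumes "f holomorphic_on disk" "g holomorphic_on disk"
  shows "hadamard f g holomorphic_on disk"
  unfolding holomorphic_on_open[OF open_ball]
  using power_series_deriv_sums(2)[OF hadamard_sums[OF assms]] by blast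

lemma tcoeff_hadamard:
  assumes "f holomorphic_on disk" "g holomorphic_on disk"
  shows "tcoeff (hadamard f g) n = tcoeff f n * tcoeff g n"
  using power_series_unique[OF tcoeff_sums[OF hadamard_holomorphic[OF assms]] hadamard_sums[OF assms]]
  by (rule fun_cong)

lemma tcoeff_cmult:
  assumes "f holomorphic_on disk"
  shows "tcoeff (\<lambda>z. k * f z) n = k * tcoeff f n"
proof -
  have "(\<lambda>z. k * f z) holomorphic_on disk" by (intro holomorphic_intros assms)
  from power_series_unique[OF tcoeff_sums[OF this], of "\<lambda>n. k * tcoeff f n"]
  have "tcoeff (\<lambda>z. k * f z) = (\<lambda>n. k * tcoeff f n)"
    using sums_mult[OF tcoeff_sums[OF assms], of _ k] by (simp add: mult.assoc)
  thus ?thesis by simp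
qed

section \<open>Positive real parts from the dilatation bound\<close>

lemma Re_diff_div_sum_pos:
  fixes a b :: complex
  assumes "norm b < norm a"
  shows "Re ((a - b) / (a + b)) > 0" "a + b \<noteq> 0"
proof -
  show nz: "a + b \<noteq> 0" using assms by (metis add_eq_0_iff norm_minus_cancel less_irrefl)
  have "(norm b)\<^sup>2 < (norm a)\<^sup>2" using assms by (simp add: power_strict_mono)
  \<comment> \<open>The cross terms of the product form a purely imaginary number.\<close>
  moreover have "Re ((a - b) * cnj (a + b)) = (norm a)\<^sup>2 - (norm b)\<^sup>2"
    by (simp add: cmod_power2) (simp add: power2_eq_square algebra_simps)
  ultimately have "Re ((a - b) * cnj (a + b)) > 0" by simp
  moreover have "Re ((a - b) / (a + b)) = Re ((a - b) * cnj (a + b)) / (norm (a + b))\<^sup>2"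
    by (subst complex_div_cnj) (simp only: Re_divide_of_real)
  ultimately show "Re ((a - b) / (a + b)) > 0" using nz by simp
qed

lemma one_plus_minus_nonzero:
  fixes z :: complex
  assumes "norm z < 1" shows "1 + z \<noteq> 0" "1 - z \<noteq> 0"
  using assms by (auto simp: add_eq_0_iff)

text \<open>In the coordinate \<open>u = c * w / (1 - E * w)\<close>, which is \<open>h + k\<close>
  itself, the function \<open>h - k\<close> has derivative \<open>(h' - k') / (h' + k')\<close>, of
  positive real part. As \<open>u\<close> ranges over a half plane, which is convex, the segment
  argument applies.\<close>

lemma half_plane_difference_quotient:
  fixes E :: complex and c :: real
  assumes hol: "h holomorphic_on disk" "k holomorphic_on disk"
    and dil: "\<And>z. z \<in> disk \<Longrightarrow> norm (deriv k z) < norm (deriv h z)"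
    and E: "norm E = 1" and c: "c > 0"
    and sum: "\<And>z. z \<in> disk \<Longrightarrow> h z + k z = of_real c * z / (1 - E * z)"
    and z: "z1 \<in> disk" "z2 \<in> disk" "z1 \<noteq> z2"
  shows "Re (((h z1 - k z1) - (h z2 - k z2)) /
             (of_real c * z1 / (1 - E * z1) - of_real c * z2 / (1 - E * z2))) > 0"
proof -
  \<comment> \<open>The condition says that the inverse map \<open>m\<close> below takes values in
    the disk. It describes a half plane, since \<open>inner (cnj E) u\<close> is the real part of
    \<open>E * u\<close>.\<close>
  define H where "H = {u. norm u < norm (of_real c + E * u)}"
  have "norm u < norm (of_real c + E * u) \<longleftrightarrow> - c / 2 < inner (cnj E) u" for u
  proof -
    have "(norm (of_real c + E * u))\<^sup>2 = c\<^sup>2 + 2 * c * Re (E * u) + (norm (E * u))\<^sup>2"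
      unfolding cmod_power2 by (simp add: power2_eq_square algebra_simps)
    also have "\<dots> = (norm u)\<^sup>2 + c * (c + 2 * inner (cnj E) u)"
      using E by (simp add: norm_mult inner_complex_def power2_eq_square algebra_simps)
    finally have "(norm u)\<^sup>2 < (norm (of_real c + E * u))\<^sup>2 \<longleftrightarrow> 0 < c * (c + 2 * inner (cnj E) u)"
      by simp
    also have "\<dots> \<longleftrightarrow> - c / 2 < inner (cnj E) u" using c by (auto simp: zero_less_mult_iff)
    finally show ?thesis by (metis norm_ge_zero power2_less_imp_less power_strict_mono zero_less_numeral)
  qed
  hence H: "H = {u. inner (cnj E) u > - c / 2}" by (simp add: H_def)
  define m where "m u = u / (of_real c + E * u)" for u
  have nz: "of_real c + E * u \<noteq> 0" if "u \<in> H" for u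
    using that by (metis H_def mem_Collect_eq norm_not_less_zero norm_zero)
  have mdisk: "m u \<in> disk" if "u \<in> H" for u
    using that nz[OF that] by (simp add: m_def H_def norm_divide)
  have nz1: "1 - E * w \<noteq> 0" if "w \<in> disk" for w
    using that E by (intro one_plus_minus_nonzero) (simp add: norm_mult)
  define A where "A w = h w - k w" for w
  have holA: "A holomorphic_on disk" unfolding A_def by (intro holomorphic_intros hol)
  have derA: "deriv A w = deriv h w - deriv k w" if "w \<in> disk" for w
    unfolding A_def using that hol
    by (intro deriv_diff) (auto simp: holomorphic_on_open field_differentiable_def)
  have derS: "deriv h w + deriv k w = of_real c / (1 - E * w)\<^sup>2" if "w \<in> disk" for w
  proof -
    have "((\<lambda>w. h w + k w) has_field_derivative deriv h w + deriv k w) (at w)"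
      using that hol by (intro DERIV_add holomorphic_derivI[OF _ open_ball]) auto
    hence "((\<lambda>w. of_real c * w / (1 - E * w)) has_field_derivative deriv h w + deriv k w) (at w)"
      by (rule has_field_derivative_transform_within_open[of _ _ _ disk]) (use that sum in auto)
    moreover have "((\<lambda>w. of_real c * w / (1 - E * w)) has_field_derivative of_real c / (1 - E * w)\<^sup>2) (at w)"
      using nz1[OF that] by (auto intro!: derivative_eq_intros simp: power2_eq_square divide_simps) (simp add: algebra_simps)
    ultimately show ?thesis by (rule DERIV_unique)
  qed
  have derB: "((A \<circ> m) has_field_derivative
      (deriv h (m u) - deriv k (m u)) / (deriv h (m u) + deriv k (m u))) (at u)" if "u \<in> H" for u
  proof -
    have "1 - E * m u = of_real c / (of_real c + E * u)"
      using nz[OF that] by (simp add: m_def divide_simps)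
    hence S: "deriv h (m u) + deriv k (m u) = (of_real c + E * u)\<^sup>2 / of_real c"
      using derS[OF mdisk[OF that]] nz[OF that] c by (simp add: power2_eq_square)
    \<comment> \<open>This derivative is the reciprocal of \<open>deriv h + deriv k\<close> at
      \<open>m u\<close>, which produces the quotient of difference and sum.\<close>
    have "(m has_field_derivative of_real c / (of_real c + E * u)\<^sup>2) (at u)"
      unfolding m_def using nz[OF that]
      by (auto intro!: derivative_eq_intros simp: power2_eq_square divide_simps)
    moreover have "(A has_field_derivative deriv A (m u)) (at (m u))"
      using holomorphic_derivI[OF holA open_ball mdisk[OF that]] .
    ultimately have "((A \<circ> m) has_field_derivative deriv A (m u) * (of_real c / (of_real c + E * u)\<^sup>2)) (at u)"
      by (rule DERIV_chain[rotated])
    thus ?thesis unfolding S derA[OF mdisk[OF that]] using c by (simp add: mult.commute)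
  qed
  have inH: "of_real c * w / (1 - E * w) \<in> H" "m (of_real c * w / (1 - E * w)) = w" if "w \<in> disk" for w
  proof -
    have *: "of_real c + E * (of_real c * w / (1 - E * w)) = of_real c / (1 - E * w)"
      using nz1[OF that] by (simp add: divide_simps) (simp add: algebra_simps)
    show "of_real c * w / (1 - E * w) \<in> H"
      unfolding H_def mem_Collect_eq * using that nz1[OF that] c by (simp add: norm_divide norm_mult divide_strict_right_mono)
    show "m (of_real c * w / (1 - E * w)) = w" unfolding m_def * using nz1[OF that] c by simp
  qed
  have "Re (((A \<circ> m) (of_real c * z1 / (1 - E * z1)) - (A \<circ> m) (of_real c * z2 / (1 - E * z2))) /
             (of_real c * z1 / (1 - E * z1) - of_real c * z2 / (1 - E * z2))) > 0"
  proof (rule Re_difference_quotient_pos[of H])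
    show "convex H" unfolding H by (rule convex_halfspace_gt)
    show "open H" unfolding H by (rule open_halfspace_gt)
    thus "(A \<circ> m) holomorphic_on H" using derB by (auto simp: holomorphic_on_open)
    show "of_real c * z1 / (1 - E * z1) \<noteq> of_real c * z2 / (1 - E * z2)" using inH(2) z by metis
    show "0 < Re (deriv (A \<circ> m) u)" if "u \<in> H" for u
      unfolding DERIV_imp_deriv[OF derB[OF that]] by (intro Re_diff_div_sum_pos dil mdisk that)
  qed (use inH z in auto)
  thus ?thesis using inH(2) z by (simp add: A_def)
qed

text \<open>\<open>c * z / (1 - E * z)\<close> is \<open>c / E\<close> times a geometric series
  without its constant term. Up to the factor \<open>c / E\<close> and the constant term, a Hadamard
  product with it is therefore the rotation of the argument by \<open>E\<close>.\<close>

lemma coefficients_of_half_plane_map: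
  fixes E c :: complex
  assumes E: "norm E = 1" and t: "\<And>z. z \<in> disk \<Longrightarrow> (\<lambda>n. t n * z ^ n) sums (c * z / (1 - E * z))"
  shows "t n = (if n = 0 then 0 else c / E * E ^ n)"
proof -
  have E0: "E \<noteq> 0" using E by auto
  have "(\<lambda>n. (if n = 0 then 0 else c / E * E ^ n) * z ^ n) sums (c * z / (1 - E * z))" if "z \<in> disk" for z
  proof -
    have "norm (E * z) < 1" using that E by (simp add: norm_mult)
    hence "(\<lambda>n. c / E * (E * z) ^ n) sums (c / E * (1 / (1 - E * z)))"
      by (intro sums_mult geometric_sums)
    from sums_diff[OF this sums_single[of 0 "\<lambda>_. c / E"]]
    have "(\<lambda>n. (if n = 0 then 0 else c / E * E ^ n) * z ^ n) sums (c / E * (1 / (1 - E * z)) - c / E)"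
      by (rule sums_cong[THEN iffD1, rotated]) (auto simp: power_mult_distrib)
    moreover have "c / E * (1 / (1 - E * z)) - c / E = c * z / (1 - E * z)"
      using E0 one_plus_minus_nonzero(2)[OF \<open>norm (E * z) < 1\<close>] by (simp add: divide_simps) (simp add: algebra_simps)
    ultimately show ?thesis by simp
  qed
  from power_series_unique[OF t this] show ?thesis by (rule fun_cong)
qed

text \<open>Partial fractions, with
  \<open>cis \<beta> - cis (- \<beta>) = 2 * \<i> * sin \<beta>\<close>. The series is
  \<open>z\<close> times the derivative of the strip map; a difference of two geometric sequences
  makes the Hadamard product a difference of values at two rotated points.\<close>

lemma coefficients_of_strip_map:
  fixes N d :: complex
  assumes N: "norm N = 1" and \<beta>: "sin \<beta> \<noteq> 0"
    and t: "\<And>z. z \<in> disk \<Longrightarrow> (\<lambda>n. t n * z ^ n) sums (z * (d / ((1 + z * N * cis \<beta>) * (1 + z * N * cis (- \<beta>)))))"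
  shows "t n = d / (2 * \<i> * of_real (sin \<beta>) * N) * ((- N * cis (- \<beta>)) ^ n - (- N * cis \<beta>) ^ n)"
proof -
  have N0: "N \<noteq> 0" using N by auto
  have cd: "cis \<beta> - cis (- \<beta>) = 2 * \<i> * of_real (sin \<beta>)" by (simp add: complex_eq_iff)
  define K where "K = d / (2 * \<i> * of_real (sin \<beta>) * N)"
  have "(\<lambda>n. K * ((- N * cis (- \<beta>)) ^ n - (- N * cis \<beta>) ^ n) * z ^ n) sums
      (z * (d / ((1 + z * N * cis \<beta>) * (1 + z * N * cis (- \<beta>)))))" if "z \<in> disk" for z
  proof -
    have n: "norm (- N * cis \<theta> * z) < 1" for \<theta> using that N by (simp add: norm_mult)
    have nz: "1 + z * N * cis \<theta> \<noteq> 0" for \<theta>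
      using one_plus_minus_nonzero(2)[OF n[of \<theta>]] by (simp add: mult_ac)
    have g: "(\<lambda>n. (- N * cis \<theta> * z) ^ n) sums (1 / (1 + z * N * cis \<theta>))" for \<theta>
      using geometric_sums[OF n[of \<theta>]] by (simp add: mult_ac)
    have S: "(\<lambda>n. K * ((- N * cis (- \<beta>) * z) ^ n - (- N * cis \<beta> * z) ^ n)) sums
       (K * (1 / (1 + z * N * cis (- \<beta>)) - 1 / (1 + z * N * cis \<beta>)))"
      by (intro sums_mult sums_diff g)
    have "1 / (1 + z * N * cis (- \<beta>)) - 1 / (1 + z * N * cis \<beta>) =
        z * N * (cis \<beta> - cis (- \<beta>)) / ((1 + z * N * cis \<beta>) * (1 + z * N * cis (- \<beta>)))"
      using nz[of \<beta>] nz[of "- \<beta>"] by (subst diff_frac_eq) (auto simp: algebra_simps)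
    hence R: "K * (1 / (1 + z * N * cis (- \<beta>)) - 1 / (1 + z * N * cis \<beta>)) =
        z * (d / ((1 + z * N * cis \<beta>) * (1 + z * N * cis (- \<beta>))))"
      unfolding cd K_def using N0 \<beta> by simp
    show ?thesis
      using S unfolding R power_mult_distrib[of _ z] by (simp only: left_diff_distrib mult.assoc)
  qed
  from power_series_unique[OF t this] show ?thesis unfolding K_def by (rule fun_cong)
qed

section \<open>The derivative of the sheared convolution\<close>

lemma hadamard_deriv_sums:
  assumes "f holomorphic_on disk" "g holomorphic_on disk" "z \<in> disk"
  shows "(\<lambda>n. of_nat n * (tcoeff f n * tcoeff g n) * z ^ n) sums (z * deriv (hadamard f g) z)"
  by (rule power_series_deriv_sums(1)) (use hadamard_sums assms in auto)

lemma tcoeff_deriv_sums: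
  assumes "f holomorphic_on disk" "z \<in> disk"
  shows "(\<lambda>n. of_nat n * tcoeff f n * z ^ n) sums (z * deriv f z)"
  by (rule power_series_deriv_sums(1)) (use tcoeff_sums assms in auto)

text \<open>Coefficientwise,
  \<open>2 * (p * q - r * s) = (p - r) * (q + s) + (p + r) * (q - s)\<close>, with the factor
  \<open>n\<close> of the derivative attached to \<open>q\<close> and \<open>s\<close>. The sums
  \<open>n * (q + s)\<close> and \<open>p + r\<close> are explicit, so the first product evaluates
  \<open>h1 - k1\<close> at \<open>\<zeta>1\<close> and \<open>\<zeta>2\<close>, and the second
  evaluates the derivative of \<open>h2 - k2\<close> at \<open>E * z\<close>.\<close>

lemma hadamard_shear_deriv:
  fixes E N :: complex and c d \<beta> :: real
  assumes hol: "h1 holomorphic_on disk" "k1 holomorphic_on disk" "h2 holomorphic_on disk" "k2 holomorphic_on disk"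
    and E: "norm E = 1" and N: "norm N = 1" and \<beta>: "sin \<beta> \<noteq> 0"
    and sum1: "\<And>z. z \<in> disk \<Longrightarrow> h1 z + k1 z = of_real c * z / (1 - E * z)"
    and der2: "\<And>z. z \<in> disk \<Longrightarrow> deriv h2 z + deriv k2 z = of_real d / ((1 + z * N * cis \<beta>) * (1 + z * N * cis (- \<beta>)))"
    and z: "z \<in> disk"
  defines "\<zeta>1 \<equiv> - N * cis (- \<beta>) * z" and "\<zeta>2 \<equiv> - N * cis \<beta> * z"
  shows "z * (deriv (hadamard h1 h2) z - deriv (hadamard k1 k2) z) =
    1/2 * (of_real d / (2 * \<i> * of_real (sin \<beta>) * N) * ((h1 \<zeta>1 - k1 \<zeta>1) - (h1 \<zeta>2 - k1 \<zeta>2))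
           + of_real c * z * (deriv h2 (E * z) - deriv k2 (E * z)))"
proof -
  have E0: "E \<noteq> 0" using E by auto
  have disk: "\<zeta>1 \<in> disk" "\<zeta>2 \<in> disk" "E * z \<in> disk"
    using z N E by (auto simp: \<zeta>1_def \<zeta>2_def norm_mult)
  note ts = tcoeff_sums[OF hol(1)] tcoeff_sums[OF hol(2)]
  note ds = tcoeff_deriv_sums[OF hol(3)] tcoeff_deriv_sums[OF hol(4)]
  have s1: "(\<lambda>n. (tcoeff h1 n + tcoeff k1 n) * w ^ n) sums (of_real c * w / (1 - E * w))" if "w \<in> disk" for w
    using sums_add[OF ts(1)[OF that] ts(2)[OF that]] sum1[OF that] by (simp add: distrib_right)
  have c1: "tcoeff h1 n + tcoeff k1 n = (if n = 0 then 0 else of_real c / E * E ^ n)" for n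
    by (rule coefficients_of_half_plane_map[OF E s1])
  have s2: "(\<lambda>n. (of_nat n * (tcoeff h2 n + tcoeff k2 n)) * w ^ n) sums
     (w * (of_real d / ((1 + w * N * cis \<beta>) * (1 + w * N * cis (- \<beta>)))))" if "w \<in> disk" for w
    using sums_add[OF ds(1)[OF that] ds(2)[OF that]] unfolding der2[OF that, symmetric] by (simp add: algebra_simps)
  define K where "K = of_real d / (2 * \<i> * of_real (sin \<beta>) * N)"
  have c2: "of_nat n * (tcoeff h2 n + tcoeff k2 n) = K * ((- N * cis (- \<beta>)) ^ n - (- N * cis \<beta>) ^ n)" for n
    unfolding K_def by (rule coefficients_of_strip_map[OF N \<beta> s2])
  have "(\<lambda>n. tcoeff h1 n * w ^ n - tcoeff k1 n * w ^ n) sums (h1 w - k1 w)" if "w \<in> disk" for w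
    by (intro sums_diff ts that)
  from sums_mult[OF sums_diff[OF this[OF disk(1)] this[OF disk(2)]], of K]
  have T1: "(\<lambda>n. (tcoeff h1 n - tcoeff k1 n) * (of_nat n * (tcoeff h2 n + tcoeff k2 n)) * z ^ n) sums
      (K * ((h1 \<zeta>1 - k1 \<zeta>1) - (h1 \<zeta>2 - k1 \<zeta>2)))"
    unfolding c2 \<zeta>1_def \<zeta>2_def
    by (simp only: power_mult_distrib[of _ z]) (simp add: algebra_simps)
  from sums_mult[OF sums_diff[OF ds(1)[OF disk(3)] ds(2)[OF disk(3)]], of "of_real c / E"]
  have "(\<lambda>n. of_real c / E * (of_nat n * tcoeff h2 n * (E * z) ^ n - of_nat n * tcoeff k2 n * (E * z) ^ n)) sums
      (of_real c * z * (deriv h2 (E * z) - deriv k2 (E * z)))"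
    using E0 by (simp add: algebra_simps)
  \<comment> \<open>At \<open>n = 0\<close> the factor \<open>of_nat n\<close> kills both sides, so
    the exceptional constant term of \<open>h1 + k1\<close> does no harm.\<close>
  moreover have "of_real c / E * (of_nat n * tcoeff h2 n * (E * z) ^ n - of_nat n * tcoeff k2 n * (E * z) ^ n)
      = (tcoeff h1 n + tcoeff k1 n) * (of_nat n * (tcoeff h2 n - tcoeff k2 n)) * z ^ n" for n
    unfolding c1 by (simp add: power_mult_distrib algebra_simps)
  ultimately have T2: "(\<lambda>n. (tcoeff h1 n + tcoeff k1 n) * (of_nat n * (tcoeff h2 n - tcoeff k2 n)) * z ^ n) sums
      (of_real c * z * (deriv h2 (E * z) - deriv k2 (E * z)))" by simp
  have L: "(\<lambda>n. of_nat n * (tcoeff h1 n * tcoeff h2 n) * z ^ n - of_nat n * (tcoeff k1 n * tcoeff k2 n) * z ^ n) sums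
     (z * deriv (hadamard h1 h2) z - z * deriv (hadamard k1 k2) z)"
    by (intro sums_diff hadamard_deriv_sums hol z)
  have "of_nat n * (tcoeff h1 n * tcoeff h2 n) * z ^ n - of_nat n * (tcoeff k1 n * tcoeff k2 n) * z ^ n
     = 1/2 * ((tcoeff h1 n - tcoeff k1 n) * (of_nat n * (tcoeff h2 n + tcoeff k2 n)) * z ^ n
       + (tcoeff h1 n + tcoeff k1 n) * (of_nat n * (tcoeff h2 n - tcoeff k2 n)) * z ^ n)" for n
    by (simp add: algebra_simps)
  with L sums_mult[OF sums_add[OF T1 T2], of "1/2"] show ?thesis
    unfolding K_def right_diff_distrib[of z] by (simp only: sums_unique2)
qed

text \<open>Away from 0 the derivative equals \<open>c * d / 2 * (R + p) / (P * Q)\<close>, where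
  \<open>R\<close> is the half plane difference quotient of \<open>h1 - k1\<close> and
  \<open>p\<close> the quotient of difference and sum of \<open>deriv h2\<close> and
  \<open>deriv k2\<close>. Both have positive real part, and the quadratic in the claim is
  \<open>P * Q\<close>.\<close>

lemma hadamard_shear_deriv_pos:
  fixes E N :: complex and c d \<beta> :: real
  assumes hol: "h1 holomorphic_on disk" "k1 holomorphic_on disk" "h2 holomorphic_on disk" "k2 holomorphic_on disk"
    and dil1: "\<And>z. z \<in> disk \<Longrightarrow> norm (deriv k1 z) < norm (deriv h1 z)"
    and dil2: "\<And>z. z \<in> disk \<Longrightarrow> norm (deriv k2 z) < norm (deriv h2 z)"
    and h0: "deriv h1 0 = 1" "deriv h2 0 = 1"
    and E: "norm E = 1" and N: "norm N = 1" and c: "c > 0" and d: "d > 0" and \<beta>: "sin \<beta> > 0"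
    and sum1: "\<And>z. z \<in> disk \<Longrightarrow> h1 z + k1 z = of_real c * z / (1 - E * z)"
    and der2: "\<And>z. z \<in> disk \<Longrightarrow> deriv h2 z + deriv k2 z = of_real d / ((1 + z * N * cis \<beta>) * (1 + z * N * cis (- \<beta>)))"
    and z: "z \<in> disk"
  shows "Re ((deriv (hadamard h1 h2) z - deriv (hadamard k1 k2) z) *
     ((1 + E * N * z * cis \<beta>) * (1 + E * N * z * cis (- \<beta>)))) > 0"
proof (cases "z = 0")
  \<comment> \<open>The formula for \<open>z\<close> times the derivative says nothing at 0. There
    the derivative is 1 minus a product of two numbers of modulus less than 1.\<close>
  case True
  have t1: "tcoeff f (Suc 0) = deriv f 0" for f by (simp add: tcoeff_def)
  have "deriv (hadamard h1 h2) 0 = 1" "deriv (hadamard k1 k2) 0 = deriv k1 0 * deriv k2 0"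
    using tcoeff_hadamard[OF hol(1,3), of 1] tcoeff_hadamard[OF hol(2,4), of 1] h0 by (simp_all add: t1)
  moreover have "norm (deriv k1 0 * deriv k2 0) < 1"
  proof -
    have "norm (deriv k1 0) * norm (deriv k2 0) < 1 * 1"
      using dil1[of 0] dil2[of 0] h0 by (intro mult_strict_mono') auto
    thus ?thesis by (simp add: norm_mult)
  qed
  hence "Re (deriv k1 0 * deriv k2 0) < 1" by (meson complex_Re_le_cmod order_le_less_trans)
  ultimately show ?thesis using True by simp
next
  case False
  define \<zeta>1 \<zeta>2 where "\<zeta>1 = - N * cis (- \<beta>) * z" and "\<zeta>2 = - N * cis \<beta> * z"
  define P where "P = 1 + E * N * z * cis \<beta>"
  define Q where "Q = 1 + E * N * z * cis (- \<beta>)"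
  have N0: "N \<noteq> 0" using N by auto
  have cd: "cis \<beta> - cis (- \<beta>) = 2 * \<i> * of_real (sin \<beta>)" by (simp add: complex_eq_iff)
  have disk: "\<zeta>1 \<in> disk" "\<zeta>2 \<in> disk" "E * z \<in> disk"
    using z N E by (auto simp: \<zeta>1_def \<zeta>2_def norm_mult)
  \<comment> \<open>This factor cancels the constant \<open>d / (2 * \<i> * sin \<beta> * N)\<close>
    down to \<open>d * z\<close>, matching the second term.\<close>
  have z12: "\<zeta>1 - \<zeta>2 = N * z * (2 * \<i> * of_real (sin \<beta>))"
    unfolding cd[symmetric] by (simp add: \<zeta>1_def \<zeta>2_def algebra_simps)
  have ne: "\<zeta>1 \<noteq> \<zeta>2" using z12 N0 False \<beta> by auto
  have PQ: "P = 1 - E * \<zeta>2" "Q = 1 - E * \<zeta>1" by (simp_all add: P_def Q_def \<zeta>1_def \<zeta>2_def mult_ac)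
  have PQ0: "P \<noteq> 0" "Q \<noteq> 0"
    unfolding PQ using disk E by (intro one_plus_minus_nonzero(2), simp add: norm_mult)+
  define R where "R = ((h1 \<zeta>1 - k1 \<zeta>1) - (h1 \<zeta>2 - k1 \<zeta>2)) /
             (of_real c * \<zeta>1 / (1 - E * \<zeta>1) - of_real c * \<zeta>2 / (1 - E * \<zeta>2))"
  have R: "Re R > 0"
    unfolding R_def by (rule half_plane_difference_quotient[OF hol(1,2) dil1 E c sum1 disk(1,2) ne])
  have dif: "of_real c * \<zeta>1 / (1 - E * \<zeta>1) - of_real c * \<zeta>2 / (1 - E * \<zeta>2) = of_real c * (\<zeta>1 - \<zeta>2) / (P * Q)"
    using PQ0 unfolding PQ by (subst diff_frac_eq) (auto simp: algebra_simps)
  have dif0: "of_real c * (\<zeta>1 - \<zeta>2) / (P * Q) \<noteq> 0" using c ne PQ0 by simp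
  hence A: "(h1 \<zeta>1 - k1 \<zeta>1) - (h1 \<zeta>2 - k1 \<zeta>2) = R * (of_real c * (\<zeta>1 - \<zeta>2) / (P * Q))"
    unfolding R_def dif by simp
  define p where "p = (deriv h2 (E * z) - deriv k2 (E * z)) / (deriv h2 (E * z) + deriv k2 (E * z))"
  have p: "Re p > 0" "deriv h2 (E * z) + deriv k2 (E * z) \<noteq> 0"
    unfolding p_def by (rule Re_diff_div_sum_pos[OF dil2[OF disk(3)]])+
  have EzN: "E * z * N = E * N * z" by simp
  have sum2: "deriv h2 (E * z) + deriv k2 (E * z) = of_real d / (P * Q)"
    using der2[OF disk(3)] unfolding P_def Q_def EzN .
  have "deriv h2 (E * z) - deriv k2 (E * z) = p * (of_real d / (P * Q))"
    using p(2) unfolding p_def sum2[symmetric] by simp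
  hence "z * (deriv (hadamard h1 h2) z - deriv (hadamard k1 k2) z) =
     1/2 * (of_real d / (2 * \<i> * of_real (sin \<beta>) * N) * (R * (of_real c * (\<zeta>1 - \<zeta>2) / (P * Q)))
       + of_real c * z * (p * (of_real d / (P * Q))))"
    using hadamard_shear_deriv[OF hol E N _ sum1 der2 z] \<beta> A by (simp add: \<zeta>1_def \<zeta>2_def)
  also have "\<dots> = z * (of_real (c * d / 2) * (R + p) / (P * Q))"
    unfolding z12 using N0 \<beta> PQ0 by (simp add: field_simps)
  finally have "deriv (hadamard h1 h2) z - deriv (hadamard k1 k2) z = of_real (c * d / 2) * (R + p) / (P * Q)"
    unfolding mult_cancel_left using False by blast
  hence "(deriv (hadamard h1 h2) z - deriv (hadamard k1 k2) z) * (P * Q) = of_real (c * d / 2) * (R + p)"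
    using PQ0 by simp
  moreover have "Re (of_real (c * d / 2) * (R + p)) > 0"
    using R p(1) c d
    unfolding scaleR_conv_of_real[symmetric] scaleR_complex.sel plus_complex.sel by (intro mult_pos_pos) auto
  ultimately show ?thesis unfolding P_def Q_def by (simp only:)
qed

section \<open>Convexity of the convolution\<close>

text \<open>Multiplying by \<open>cis \<theta>\<close> makes the direction \<open>- \<theta>\<close>
  horizontal, and \<open>Z\<close> parametrizes the disk by a vertical strip. The quadratic in the
  hypothesis is, up to constants, the derivative of \<open>Z\<close>, so the hypothesis says
  precisely that \<open>deriv G\<close> has positive real part.\<close>

lemma convex_in_direction_shear:
  fixes \<theta> \<beta> :: real
  assumes \<beta>: "0 < \<beta>" "\<beta> < pi"
    and hol: "H holomorphic_on disk" "K holomorphic_on disk"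
    and pos: "\<And>z. z \<in> disk \<Longrightarrow> Re ((deriv H z - cis (- 2 * \<theta>) * deriv K z) *
        ((1 + cis \<theta> * z * cis \<beta>) * (1 + cis \<theta> * z * cis (- \<beta>)))) > 0"
    and loc: "locally_univalent (harm H K) disk"
  shows "convex_in_direction (harm H K) (- \<theta>)"
proof -
  define S where "S = {s. (\<beta> - pi) / 2 < Re s \<and> Re s < \<beta> / 2}"
  define Z where "Z s = cis (- \<theta>) * (sin s / sin (of_real \<beta> - s))" for s
  \<comment> \<open>Conjugation sends \<open>cis (- \<theta>) * K\<close> to
    \<open>cis \<theta> * cnj K\<close> and flips the sign of the imaginary part; hence the minus
    sign, which gives \<open>Im G = Im q\<close>.\<close>
  define G where "G s = cis \<theta> * H (Z s) - cis (- \<theta>) * K (Z s)" for s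
  define q where "q s = cis \<theta> * harm H K (Z s)" for s
  have cc: "cis \<theta> * cis (- \<theta>) = 1" "cis (- \<theta>) * cis \<theta> = 1" by (simp_all add: cis_mult)
  have Zdisk: "Z s \<in> disk" if "s \<in> S" for s
    using strip_ratio_in_disk[OF \<beta>, of s] that by (simp add: Z_def S_def norm_mult norm_divide)
  have Z_surj: "Z ` S = disk"
  proof (intro equalityI subsetI)
    fix z assume "z \<in> disk"
    hence "norm (cis \<theta> * z) < 1" by (simp add: norm_mult)
    then obtain s where s: "s \<in> S" "cis \<theta> * z = sin s / sin (of_real \<beta> - s)"
      using strip_ratio_surj[OF \<beta>] unfolding S_def by (metis mem_Collect_eq)
    have "Z s = (cis (- \<theta>) * cis \<theta>) * z" unfolding Z_def s(2)[symmetric] by (simp only: mult.assoc)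
    thus "z \<in> Z ` S" using s(1) cc(2) by force
  qed (use Zdisk in auto)
  have Z_inj: "inj_on Z S"
    using strip_ratio_inj[OF \<beta>] unfolding Z_def S_def inj_on_def mult_cancel_left by simp
  have Z_der: "(Z has_field_derivative cis (- \<theta>) *
      ((1 + cis \<theta> * Z s * cis \<beta>) * (1 + cis \<theta> * Z s * cis (- \<beta>)) / of_real (sin \<beta>))) (at s)"
    if "s \<in> S" for s
  proof -
    have "sin (of_real \<beta> - s) \<noteq> 0" using that strip_sin_nonzero[OF \<beta>] by (simp add: S_def)
    from DERIV_cmult[OF strip_ratio_deriv[OF \<beta> this], of "cis (- \<theta>)"]
    show ?thesis by (simp add: Z_def[abs_def] mult.assoc[symmetric] cc)
  qed
  have openS: "open S"
    unfolding S_def Collect_conj_eq by (intro open_Int open_halfspace_Re_lt open_halfspace_Re_gt)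
  have contZ: "continuous_on S Z"
    using Z_der openS by (meson DERIV_isCont continuous_at_imp_continuous_on)
  have G_der: "(G has_field_derivative (deriv H (Z s) - cis (- 2 * \<theta>) * deriv K (Z s)) *
        ((1 + cis \<theta> * Z s * cis \<beta>) * (1 + cis \<theta> * Z s * cis (- \<beta>))) / of_real (sin \<beta>)) (at s)"
    if "s \<in> S" for s
  proof -
    define D where "D = (1 + cis \<theta> * Z s * cis \<beta>) * (1 + cis \<theta> * Z s * cis (- \<beta>)) / of_real (sin \<beta>)"
    note ch = DERIV_chain2[OF holomorphic_derivI[OF _ open_ball Zdisk[OF that]] Z_der[OF that, folded D_def]]
    have "(G has_field_derivative cis \<theta> * (deriv H (Z s) * (cis (- \<theta>) * D)) - cis (- \<theta>) * (deriv K (Z s) * (cis (- \<theta>) * D))) (at s)"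
      unfolding G_def by (intro DERIV_diff DERIV_cmult ch hol)
    moreover have "cis (- 2 * \<theta>) = cis (- \<theta>) * cis (- \<theta>)" by (simp add: cis_mult)
    hence "cis \<theta> * (deriv H (Z s) * (cis (- \<theta>) * D)) - cis (- \<theta>) * (deriv K (Z s) * (cis (- \<theta>) * D))
       = (deriv H (Z s) - cis (- 2 * \<theta>) * deriv K (Z s)) * D"
      using cc(1) by algebra
    ultimately show ?thesis by (simp add: D_def)
  qed
  have sin0: "sin \<beta> > 0" using \<beta> by (rule sin_gt_zero)
  have G_pos: "Re (deriv G s) > 0" if "s \<in> S" for s
    using pos[OF Zdisk[OF that]] sin0
    unfolding DERIV_imp_deriv[OF G_der[OF that]] Re_divide_of_real by simp
  have G_hol: "G holomorphic_on S" using G_der openS by (auto simp: holomorphic_on_open)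
  have q_cont: "continuous_on S q"
    unfolding q_def harm_def
    by (intro continuous_intros continuous_on_compose2[OF holomorphic_on_imp_continuous_on[OF hol(1)] contZ]
          continuous_on_compose2[OF holomorphic_on_imp_continuous_on[OF hol(2)] contZ]) (use Zdisk in auto)
  have q_Im: "Im (q s) = Im (G s)" if "s \<in> S" for s
    by (simp add: q_def G_def harm_def algebra_simps)
  have q_eq: "q s = q t \<longleftrightarrow> harm H K (Z s) = harm H K (Z t)" for s t by (simp add: q_def)
  have q_loc: "\<exists>e>0. inj_on q (S \<inter> ball s e)" if s: "s \<in> S" for s
  proof -
    obtain r where r: "r > 0" "inj_on (harm H K) (ball (Z s) r)"
      using loc Zdisk[OF s] unfolding locally_univalent_def by blast
    obtain e where e: "e > 0" "\<And>t. t \<in> S \<Longrightarrow> dist t s < e \<Longrightarrow> dist (Z t) (Z s) < r"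
      using contZ s r(1) unfolding continuous_on_iff by metis
    have "inj_on q (S \<inter> ball s e)"
    proof (rule inj_onI)
      fix t t' assume t: "t \<in> S \<inter> ball s e" "t' \<in> S \<inter> ball s e" "q t = q t'"
      have "Z t \<in> ball (Z s) r" "Z t' \<in> ball (Z s) r"
        using e(2)[of t] e(2)[of t'] t by (auto simp: dist_commute)
      hence "Z t = Z t'" using r(2) t(3) unfolding q_eq by (meson inj_onD)
      thus "t = t'" using Z_inj t by (auto dest: inj_onD)
    qed
    thus ?thesis using e(1) by blast
  qed
  note shear = G_hol[unfolded S_def] G_pos[unfolded S_def] q_cont[unfolded S_def] q_Im[unfolded S_def] q_loc[unfolded S_def]
  have "inj_on q S" unfolding S_def by (rule strip_shear_inj[OF shear])
  hence inj: "inj_on (harm H K) disk"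
    unfolding Z_surj[symmetric] inj_on_def q_eq by blast
  have conv: "convex (harm H K ` disk \<inter> {w + of_real t * exp (\<i> * of_real (- \<theta>)) | t. True})" for w
  proof -
    define c where "c = Im (cis \<theta> * w)"
    define X where "X = {x. Complex x c \<in> q ` S}"
    have X: "convex X"
      using strip_shear_level(2)[OF shear] by (simp add: X_def S_def is_interval_convex_1)
    have ex: "exp (\<i> * of_real (- \<theta>)) = cis (- \<theta>)" by (simp add: cis_conv_exp)
    have qS: "q ` S = (\<lambda>p. cis \<theta> * p) ` (harm H K ` disk)"
      unfolding Z_surj[symmetric] image_image q_def ..
    have "harm H K ` disk \<inter> {w + of_real t * cis (- \<theta>) | t. True}
        = (+) (cis (- \<theta>) * Complex 0 c) ` (\<lambda>x. x *\<^sub>R cis (- \<theta>)) ` X"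
    proof (intro equalityI subsetI)
      fix p assume p: "p \<in> harm H K ` disk \<inter> {w + of_real t * cis (- \<theta>) | t. True}"
      then obtain t where t: "p = w + of_real t * cis (- \<theta>)" by auto
      have "cis \<theta> * p = cis \<theta> * w + of_real t * (cis \<theta> * cis (- \<theta>))" unfolding t by (simp only: algebra_simps)
      hence "Im (cis \<theta> * p) = c" unfolding cc c_def by simp
      hence C: "cis \<theta> * p = Complex (Re (cis \<theta> * p)) c" by (simp add: complex_eq_iff)
      have "Complex (Re (cis \<theta> * p)) c \<in> q ` S" unfolding C[symmetric] qS using p by blast
      moreover have "p = cis (- \<theta>) * (cis \<theta> * p)" using cc by (simp add: mult.assoc[symmetric])
      hence "p = cis (- \<theta>) * Complex 0 c + Re (cis \<theta> * p) *\<^sub>R cis (- \<theta>)"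
        by (subst (asm) C) (simp add: Complex_eq scaleR_conv_of_real algebra_simps)
      ultimately show "p \<in> (+) (cis (- \<theta>) * Complex 0 c) ` (\<lambda>x. x *\<^sub>R cis (- \<theta>)) ` X"
        unfolding X_def image_image by blast
    next
      fix p assume "p \<in> (+) (cis (- \<theta>) * Complex 0 c) ` (\<lambda>x. x *\<^sub>R cis (- \<theta>)) ` X"
      then obtain x where x: "x \<in> X" "p = cis (- \<theta>) * Complex 0 c + x *\<^sub>R cis (- \<theta>)" by auto
      have p: "p = cis (- \<theta>) * Complex x c"
        unfolding x(2) by (simp add: Complex_eq scaleR_conv_of_real algebra_simps)
      obtain p' where p': "p' \<in> harm H K ` disk" "Complex x c = cis \<theta> * p'" using x(1) unfolding X_def qS by auto
      have "p = p'" unfolding p p'(2) using cc by (simp add: mult.assoc[symmetric])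
      have "Complex x c = cis \<theta> * w + of_real (x - Re (cis \<theta> * w))"
        by (simp add: complex_eq_iff c_def)
      hence "p = (cis (- \<theta>) * cis \<theta>) * w + of_real (x - Re (cis \<theta> * w)) * cis (- \<theta>)"
        unfolding p by (simp only: distrib_left mult_ac)
      hence "p = w + of_real (x - Re (cis \<theta> * w)) * cis (- \<theta>)" unfolding cc by simp
      thus "p \<in> harm H K ` disk \<inter> {w + of_real t * cis (- \<theta>) | t. True}"
        using p'(1) \<open>p = p'\<close> by blast
    qed
    moreover have "convex ((\<lambda>x. x *\<^sub>R cis (- \<theta>)) ` X)"
      by (intro convex_linear_image X bounded_linear.linear bounded_linear_scaleR_left)
    ultimately show ?thesis unfolding ex using convex_translation by metis
  qed
  show ?thesis unfolding convex_in_direction_def using inj conv by blast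
qed

section \<open>The logarithmic strip map and the convolution theorem\<close>

lemma deriv_of_log_quotient:
  fixes f :: "complex \<Rightarrow> complex" and N K :: complex
  assumes f: "f holomorphic_on disk" and N: "norm N = 1" and K: "K \<noteq> 0"
    and log: "\<And>z. z \<in> disk \<Longrightarrow> f z = K * Ln ((1 + z * N * cis \<beta>) / (1 + z * N * cis (- \<beta>)))"
    and z: "z \<in> disk"
  shows "deriv f z = K * N * (2 * \<i> * of_real (sin \<beta>)) / ((1 + z * N * cis \<beta>) * (1 + z * N * cis (- \<beta>)))"
proof -
  have nz: "1 + w * N * cis \<theta> \<noteq> 0" if "w \<in> disk" for w \<theta>
    using that N by (intro one_plus_minus_nonzero) (simp add: norm_mult)
  define P where "P = 1 + z * N * cis \<beta>"
  define Q where "Q = 1 + z * N * cis (- \<beta>)"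
  have PQ: "P \<noteq> 0" "Q \<noteq> 0" using nz[OF z] by (simp_all add: P_def Q_def)
  \<comment> \<open>Exponentiating first avoids the branch cut of \<open>Ln\<close>.\<close>
  have ex: "exp (f w / K) = (1 + w * N * cis \<beta>) / (1 + w * N * cis (- \<beta>))" if "w \<in> disk" for w
    using log[OF that] nz[OF that] K by simp
  have "(f has_field_derivative deriv f z) (at z)" using holomorphic_derivI[OF f open_ball z] .
  hence "((\<lambda>w. exp (f w / K)) has_field_derivative exp (f z / K) * (deriv f z / K)) (at z)"
    by (intro DERIV_chain2[OF DERIV_exp] DERIV_cdivide)
  hence "((\<lambda>w. (1 + w * N * cis \<beta>) / (1 + w * N * cis (- \<beta>))) has_field_derivative exp (f z / K) * (deriv f z / K)) (at z)"
    by (rule has_field_derivative_transform_within_open[of _ _ _ disk]) (use z ex in auto)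
  moreover have "((\<lambda>w. (1 + w * N * cis \<beta>) / (1 + w * N * cis (- \<beta>))) has_field_derivative
      (N * cis \<beta> * Q - P * (N * cis (- \<beta>))) / (Q * Q)) (at z)"
    unfolding P_def Q_def using nz[OF z] by (auto intro!: derivative_eq_intros)
  ultimately have "exp (f z / K) * (deriv f z / K) = (N * cis \<beta> * Q - P * (N * cis (- \<beta>))) / (Q * Q)"
    by (rule DERIV_unique)
  also have "N * cis \<beta> * Q - P * (N * cis (- \<beta>)) = N * (cis \<beta> - cis (- \<beta>))"
    by (simp add: P_def Q_def algebra_simps)
  also have "cis \<beta> - cis (- \<beta>) = 2 * \<i> * of_real (sin \<beta>)" by (simp add: complex_eq_iff)
  also have "exp (f z / K) = P / Q" using ex[OF z] by (simp add: P_def Q_def)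
  finally have "P / Q * (deriv f z / K) = N * (2 * \<i> * of_real (sin \<beta>)) / (Q * Q)" .
  hence "deriv f z = K * N * (2 * \<i> * of_real (sin \<beta>)) / (P * Q)"
    using PQ K by (simp add: divide_simps mult_ac)
  thus ?thesis by (simp add: P_def Q_def)
qed

theorem theorem1:
  fixes a b :: complex and \<gamma> \<beta> :: real
    and h1 g1 h2 g2 :: "complex \<Rightarrow> complex"
  assumes "a \<in> disk" and "b \<in> disk"
    and "0 \<le> \<gamma>" and "\<gamma> < 2 * pi"
    and "0 < \<beta>" and "\<beta> < pi"
    and "in_S_dom (H_half a \<gamma>) h1 g1"
    and "\<forall>z\<in>disk. h1 z + exp (- 2 * \<i> * of_real (\<gamma> + Arg (1 + cnj a))) * g1 z
           = (1 + of_real (norm (1 + a) - 1)) * z / (1 - exp (\<i> * of_real (\<gamma> + Arg (1 + cnj a))) * z)"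
    and "in_S_dom (Omega_strip b \<beta>) h2 g2"
    and "\<forall>z\<in>disk. h2 z + exp (- 2 * \<i> * of_real (Arg (1 + cnj b))) * g2 z
           = (1 + of_real (norm (1 + b) - 1)) * exp (- \<i> * of_real (Arg (1 + cnj b)))
               / (2 * \<i> * of_real (sin \<beta>))
             * Ln ((1 + z * exp (\<i> * of_real (\<beta> + Arg (1 + cnj b))))
                   / (1 + z * exp (- \<i> * of_real (\<beta> - Arg (1 + cnj b)))))"
    and "locally_univalent (harm_conv h1 g1 h2 g2) disk"
  shows "convex_in_direction (harm_conv h1 g1 h2 g2)
           (- (\<gamma> + Arg (1 + cnj a) + Arg (1 + cnj b)))"
proof -
  define \<mu> where "\<mu> = \<gamma> + Arg (1 + cnj a)"
  define \<nu> where "\<nu> = Arg (1 + cnj b)"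
  define c where "c = norm (1 + a)"
  define d where "d = norm (1 + b)"
  \<comment> \<open>Absorbing the unimodular factors into \<open>k1\<close> and \<open>k2\<close>
    leaves the dilatation bounds unchanged and turns the hypotheses into formulas for
    \<open>h1 + k1\<close> and \<open>h2 + k2\<close>.\<close>
  define k1 where "k1 z = cis (- 2 * \<mu>) * g1 z" for z
  define k2 where "k2 z = cis (- 2 * \<nu>) * g2 z" for z
  have c: "c > 0" and d: "d > 0"
    using assms(1,2) by (auto simp: c_def d_def one_plus_minus_nonzero)
  have sin0: "sin \<beta> > 0" using assms(5,6) by (rule sin_gt_zero)
  have f1: "h1 holomorphic_on disk" "g1 holomorphic_on disk" "deriv h1 0 = 1"
      "\<And>z. z \<in> disk \<Longrightarrow> norm (deriv g1 z) < norm (deriv h1 z)"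
    and f2: "h2 holomorphic_on disk" "g2 holomorphic_on disk" "deriv h2 0 = 1"
      "\<And>z. z \<in> disk \<Longrightarrow> norm (deriv g2 z) < norm (deriv h2 z)"
    using assms(7,9) by (auto simp: in_S_dom_def in_SH_def)
  have fd: "f field_differentiable at z" if "f holomorphic_on disk" "z \<in> disk" for f :: "complex \<Rightarrow> complex" and z
    using that holomorphic_on_imp_differentiable_at open_ball by blast
  have k: "k1 holomorphic_on disk" "k2 holomorphic_on disk"
    unfolding k1_def k2_def by (intro holomorphic_intros f1 f2)+
  have dk: "deriv k1 z = cis (- 2 * \<mu>) * deriv g1 z" "deriv k2 z = cis (- 2 * \<nu>) * deriv g2 z"
    if "z \<in> disk" for z
    unfolding k1_def k2_def by (intro deriv_cmult fd f1 f2 that)+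
  have e: "exp (- 2 * \<i> * of_real x) = cis (- 2 * x)" "exp (\<i> * of_real x) = cis x"
    "exp (- \<i> * of_real x) = cis (- x)" for x
    by (simp_all add: cis_conv_exp mult_ac)
  have sum1: "h1 z + k1 z = of_real c * z / (1 - cis \<mu> * z)" if "z \<in> disk" for z
    using assms(8) that unfolding k1_def c_def \<mu>_def e by simp
  have sum2: "h2 z + k2 z = of_real d * cis (- \<nu>) / (2 * \<i> * of_real (sin \<beta>))
      * Ln ((1 + z * cis \<nu> * cis \<beta>) / (1 + z * cis \<nu> * cis (- \<beta>)))" if "z \<in> disk" for z
    using assms(10) that unfolding k2_def d_def \<nu>_def e by (simp add: mult.assoc cis_mult add.commute)
  have der2: "deriv h2 z + deriv k2 z = of_real d / ((1 + z * cis \<nu> * cis \<beta>) * (1 + z * cis \<nu> * cis (- \<beta>)))"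
    if "z \<in> disk" for z
  proof -
    have hol: "(\<lambda>z. h2 z + k2 z) holomorphic_on disk" by (intro holomorphic_intros f2 k)
    have K0: "of_real d * cis (- \<nu>) / (2 * \<i> * of_real (sin \<beta>)) \<noteq> 0" using d sin0 by simp
    have "deriv h2 z + deriv k2 z = deriv (\<lambda>z. h2 z + k2 z) z"
      by (intro deriv_add[symmetric] fd f2 k that)
    also have "\<dots> = of_real d * cis (- \<nu>) / (2 * \<i> * of_real (sin \<beta>)) * cis \<nu> * (2 * \<i> * of_real (sin \<beta>))
         / ((1 + z * cis \<nu> * cis \<beta>) * (1 + z * cis \<nu> * cis (- \<beta>)))"
      by (rule deriv_of_log_quotient[OF hol _ K0 sum2 that]) simp
    also have "of_real d * cis (- \<nu>) / (2 * \<i> * of_real (sin \<beta>)) * cis \<nu> * (2 * \<i> * of_real (sin \<beta>)) = of_real d * (cis (- \<nu>) * cis \<nu>)"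
      using sin0 by simp
    also have "cis (- \<nu>) * cis \<nu> = 1" by (simp add: cis_mult)
    finally show ?thesis by simp
  qed
  \<comment> \<open>The two unimodular factors multiply to the factor
    \<open>cis (- 2 * \<theta>)\<close> of the shear lemma with
    \<open>\<theta> = \<mu> + \<nu>\<close>, which fixes the direction of convexity.\<close>
  have hk: "hadamard k1 k2 z = cis (- 2 * (\<mu> + \<nu>)) * hadamard g1 g2 z" if "z \<in> disk" for z
  proof -
    have "cis (- 2 * (\<mu> + \<nu>)) = cis (- 2 * \<mu>) * cis (- 2 * \<nu>)" by (simp add: cis_mult algebra_simps)
    hence "(\<lambda>n. tcoeff k1 n * tcoeff k2 n * z ^ n) sums (cis (- 2 * (\<mu> + \<nu>)) * hadamard g1 g2 z)"
      using sums_mult[OF hadamard_sums[OF f1(2) f2(2) that], of "cis (- 2 * \<mu>) * cis (- 2 * \<nu>)"]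
      unfolding k1_def k2_def tcoeff_cmult[OF f1(2)] tcoeff_cmult[OF f2(2)] by (simp add: mult_ac)
    thus ?thesis using hadamard_sums[OF k that] sums_unique2 by blast
  qed
  have dhk: "deriv (hadamard k1 k2) z = cis (- 2 * (\<mu> + \<nu>)) * deriv (hadamard g1 g2) z" if "z \<in> disk" for z
  proof -
    have "((\<lambda>z. cis (- 2 * (\<mu> + \<nu>)) * hadamard g1 g2 z) has_field_derivative
        cis (- 2 * (\<mu> + \<nu>)) * deriv (hadamard g1 g2) z) (at z)"
      by (intro DERIV_cmult holomorphic_derivI[OF hadamard_holomorphic[OF f1(2) f2(2)] open_ball that])
    hence "(hadamard k1 k2 has_field_derivative cis (- 2 * (\<mu> + \<nu>)) * deriv (hadamard g1 g2) z) (at z)"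
      by (rule has_field_derivative_transform_within_open[of _ _ _ disk]) (use that hk in auto)
    thus ?thesis by (rule DERIV_imp_deriv)
  qed
  have "convex_in_direction (harm (hadamard h1 h2) (hadamard g1 g2)) (- (\<mu> + \<nu>))"
  proof (rule convex_in_direction_shear[OF assms(5,6)])
    fix z :: complex assume z: "z \<in> disk"
    have "Re ((deriv (hadamard h1 h2) z - deriv (hadamard k1 k2) z) *
       ((1 + cis \<mu> * cis \<nu> * z * cis \<beta>) * (1 + cis \<mu> * cis \<nu> * z * cis (- \<beta>)))) > 0"
      by (rule hadamard_shear_deriv_pos[OF f1(1) k(1) f2(1) k(2) _ _ f1(3) f2(3) _ _ c d sin0 sum1 der2 z])
         (use f1(4) f2(4) dk in \<open>auto simp: norm_mult\<close>)
    thus "Re ((deriv (hadamard h1 h2) z - cis (- 2 * (\<mu> + \<nu>)) * deriv (hadamard g1 g2) z) *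
       ((1 + cis (\<mu> + \<nu>) * z * cis \<beta>) * (1 + cis (\<mu> + \<nu>) * z * cis (- \<beta>)))) > 0"
      unfolding dhk[OF z] cis_mult .
  qed (use assms(11) f1 f2 in \<open>auto simp: harm_conv_def intro: hadamard_holomorphic\<close>)
  thus ?thesis by (simp add: harm_conv_def \<mu>_def \<nu>_def)
qed

end
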